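(* Let $\mathcal F$ be a Frobenius algebra over $R$ of the form $A=R[X]/((X-x_1)(X-x_2))$ described in the context. For every braid $B$, with closure $\widehat B$, the elements $\beta_{\mathcal F}(B)=\beta_{\mathcal F}(\widehat B,R)$ and $\overline\beta_{\mathcal F}(B)=\overline\beta_{\mathcal F}(\widehat B,R)$ of $C^0_{\mathcal F}(\widehat B,R)$ are (possibly equal) cycles with the following properties. (i) If $B$ and $B'$ are braids related by a sequence $\Sigma$ of transverse Markov moves, then the map $\Phi_\Sigma:C^\bullet_{\mathcal F}(\widehat B,R)\to C^\bullet_{\mathcal F}(\widehat{B'},R)$ induced by $\Sigma$ satisfies $$\Phi_\Sigma(\beta_{\mathcal F}(B))=\beta_{\mathcal F}(B'),\qquad \Phi_\Sigma(\overline\beta_{\mathcal F}(B))=\overline\beta_{\mathcal F}(B').$$ (ii) If $\Sigma$ consists of a single negative stabilization from $B$ to $B'$, then $$(x_1-x_2)\,\Phi_\Sigma(\beta_{\mathcal F}(B))=\pm\beta_{\mathcal F}(B')+d_{\mathcal F}x,\qquad (x_1-x_2)\,\Phi_\Sigma(\overline\beta_{\mathcal F}(B))=\pm\overline\beta_{\mathcal F}(B')+d_{\mathcal F}y$$ for some $x,y\in C^\bullet_{\mathcal F}(\widehat{B'},R)$.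
   Context: **Algebra.** Let $\mathbb F$ be a field, $R=\mathbb F[U,V]/(p,q)$ with $(p,q)$ a (possibly zero) prime ideal of $\mathbb F[U,V]$, and $x_1,x_2\in R$ (possibly equal). Put $A=R[X]/((X-x_1)(X-x_2))$, with product $m$, unit $\iota:R\to A$, counit $\epsilon:A\to R$ ($R$-linear, $\epsilon(1)=0$, $\epsilon(X)=1$) and coproduct $\Delta:A\to A\otimes_RA$, $\Delta(a)=(a\otimes1)(X\otimes1+1\otimes X-(x_1+x_2)\,1\otimes1)$. This is the Frobenius algebra $\mathcal F$. Put $x_\circ=X-x_1$, $x_\bullet=X-x_2$. **Complex.** Rotate a crossing of a link diagram so that the over-strand runs from SW to NE; its $0$-resolution joins SW to NW and SE to NE, its $1$-resolution joins SW to SE and NW to NE. A resolution $\underline r$ of an oriented diagram $D$ is the set of planar circles obtained by resolving every crossing; $|\underline r|$ is the number of $1$-resolutions used. Write $\underline r\prec\underline s$ if they differ at exactly one crossing, $0$-resolved in $\underline r$ and $1$-resolved in $\underline s$. A sign function assigns $\pm1$ to each pair $\underline r\prec\underline s$ so that for each square $\underline s_0\prec\underline s_1,\underline s_2\prec\underline s_3$ (four distinct resolutions) $\mathsf{sgn}(\underline s_0,\underline s_1)\mathsf{sgn}(\underline s_1,\underline s_3)=-\mathsf{sgn}(\underline s_0,\underline s_2)\mathsf{sgn}(\underline s_2,\underline s_3)$. Put $A_{\underline r}=\bigotimes_{\gamma\in\underline r}A_\gamma$ (a copy $A_\gamma$ of $A$ for each circle), $C^i_{\mathcal F}(D,R)=\bigoplus_{|\underline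 r|-n_-(D)=i}A_{\underline r}$, where $n_-(D)$ is the number of negative crossings, and let $d_{\mathcal F}$ on $A_{\underline r}$ be $\sum_{\underline r\prec\underline s}\mathsf{sgn}(\underline r,\underline s)d_{\underline r}^{\underline s}$, where $d_{\underline r}^{\underline s}$ applies $m$ to the labels of two merging circles or $\Delta$ to the label of a splitting circle, and the identity on the other circles. An enhanced state is an element $\bigotimes_{\gamma\in\underline r}\alpha_\gamma$ of some $A_{\underline r}$, and $\alpha_\gamma\in A$ is the label of $\gamma$. The oriented resolution is the one compatible with the orientation at every crossing; its summand is in degree $0$. **$\beta$-cycles.** For a circle $\gamma$ of the oriented resolution $\underline r$ of $D$, $N(\gamma)\in\mathbb Z/2$ is the number mod 2 of intersections of the circles of $\underline r$ with a generic path to infinity starting at a point of $\gamma$ pushed slightly to the left of $\gamma$. $\beta_{\mathcal F}(D,R)\in A_{\underline r}$ is the enhanced state in which $\gamma$ has label $x_\circ$ if $N(\gamma)=0$ and $x_\bullet$ if $N(\gamma)=1$; $\overline\beta_{\mathcal F}(D,R)$ is obtained by exchanging $x_\circ$ and $x_\bullet$. **Maps for Reidemeister moves.** Complexes of one diagram built from different sign functions are identified by the isomorphism acting on each $A_{\underline r}$ by $\pm\mathrm{id}$ and on the oriented resolution summand by $+\mathrm{id}$; planar isotopies induce the evident identifications. For an arc $\mathbf e$ meeting a diagram only at its endpoints, $\mathbf S(\cdot,\mathbf e)$ denotes the saddle map: on an enhanced state it applies $m$ to the labels of the two circles containing the endpoints of $\mathbf e$ if they are distinct, and $\Delta$ if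 they coincide. *$R_1^+$*: $D'_+$ is obtained from $D$ by adding a positive curl on an arc lying in the circle $\gamma'$ of a given resolution. $0$-resolving the new crossing gives $D\sqcup\bigcirc$ and $1$-resolving gives $D$, so $C_{\mathcal F}(D'_+)=(C_{\mathcal F}(D)\otimes_RA)\oplus C_{\mathcal F}(D)(-1)$ with the mapping cone differential of the saddle. Then $\Phi_1^+:C_{\mathcal F}(D)\to C_{\mathcal F}(D'_+)$ sends $\bigotimes_\gamma\alpha_\gamma$ to $\big(\bigotimes_{\gamma\ne\gamma'}\alpha_\gamma\big)\otimes\big(\alpha_{\gamma'}\otimes(x_\circ+x_\bullet)-\Delta(\alpha_{\gamma'})\big)\oplus0$ (second factor labels $\bigcirc$), and $\Psi_1^+:C_{\mathcal F}(D'_+)\to C_{\mathcal F}(D)$ sends $(x\otimes a)\oplus y$ to $\epsilon(a)x$. *$R_1^-$*: $D'_-$ is obtained by adding a negative curl; $0$-resolving the new crossing gives $D$, $1$-resolving gives $D\sqcup\bigcirc$, and $\Phi_1^-:C_{\mathcal F}(D)\to C_{\mathcal F}(D'_-)$ is $x\mapsto0\oplus(x\otimes\iota(1))$. *$R_2$*: $D''$ is obtained from $D$ by a second move on arcs $\mathbf a,\mathbf b$, with new crossings $c_1,c_2$; $D''_{ij}$ is $D''$ with $c_1$ $i$-resolved and $c_2$ $j$-resolved, named so that $D''_{10}=D$ and $D''_{01}$ contains a small circle $\gamma''$. As modules $C_{\mathcal F}(D'')=\bigoplus_{ij}C_{\mathcal F}(D''_{ij})$ up to shifts (order $00,10,01,11$).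 Then $\Psi_2:C_{\mathcal F}(D)\to C_{\mathcal F}(D'')$, $\Psi_2(x)=0\oplus x\oplus\pm(\mathbf S(x,\mathbf e)\otimes\iota(1)_{\gamma''})\oplus0$ with $\mathbf e$ joining $\mathbf a$ and $\mathbf b$, and $\Phi_2:C_{\mathcal F}(D'')\to C_{\mathcal F}(D)$, $\Phi_2(x_{00}\oplus x_{10}\oplus x_{01}\oplus x_{11})=x_{10}\pm\epsilon(x_{\gamma''})\mathbf S(x_{01},\mathbf g)$, where $x_{\gamma''}$ is the label of $\gamma''$ in $x_{01}$, $\gamma''$ is then removed, and $\mathbf g$ joins the other two local arcs of $D''_{01}$; the signs are those making these chain maps. The move is coherent (braid-like) if $\mathbf a,\mathbf b$ are oriented parallel. *Coherent $R_3$*: the move $R_3^\circ$ replaces locally $D=\sigma_2^{-1}\sigma_1\sigma_2$ by $D'=\sigma_1\sigma_2\sigma_1^{-1}$. With $c$ the middle crossing and $D_i$ the $i$-resolution of $D$ at $c$, $C_{\mathcal F}(D)=\mathrm{Cone}(\mathbf S:C_{\mathcal F}(D_0)\to C_{\mathcal F}(D_1))$. $D_0$ is related by a coherent $R_2$ to $D''$ (three parallel strands); let $f=\Phi_2:C_{\mathcal F}(D_0)\to C_{\mathcal F}(D'')$, $g=\Psi_2$ in the other direction, and $h$ a homotopy on $C_{\mathcal F}(D_0)$ with $fg=\mathrm{id}$, $gf-\mathrm{id}=dh+hd$, $hg=0$. Put $\Phi:C_{\mathcal F}(D)\to\mathrm{Cone}(\mathbf Sg)$, $(x,y)\mapsto(fx,y\pm\mathbf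 Shx)$ (sign making it a chain map), and $\Psi:\mathrm{Cone}(\mathbf Sg)\to C_{\mathcal F}(D)$, $(x,y)\mapsto(gx,y)$. Define $\Phi',\Psi'$ analogously for $D'$; the two cones are identified because $D_1$ and $D_1'$ are planar isotopic. The maps of the move and of its inverse are $\Psi_3=\Psi'\circ\Phi$ and $\Phi_3=\Psi\circ\Phi'$. Every other coherent third move is a composition of coherent second moves and $R_3^\circ$ moves, and its map is the corresponding composition. **Markov moves.** Braids are braid words, $\sigma_i$ being a positive crossing. Transverse Markov moves: braid relations, conjugation, positive stabilization $B\in B_m\mapsto B\sigma_m\in B_{m+1}$ and its inverse, positive destabilization. Negative stabilization: $B\in B_m\mapsto B\sigma_m^{-1}\in B_{m+1}$. On closures, braid relations and conjugations are sequences of coherent $R_2$, coherent $R_3$ and planar isotopies; positive (negative) stabilization is an $R_1^+$ ($R_1^-$) move adding a curl. The map $\Phi_\Sigma$ is the composition of the corresponding maps. *)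

theory Defs
  imports "HOL-Computational_Algebra.Polynomial" "HOL-Library.Function_Algebras"
begin

section \<open>The base ring\<close>

text \<open>
  \<open>\<F>[U,V]\<close> is \<^typ>\<open>'f poly poly\<close>. A ring \<open>R = \<F>[U,V]/(p,q)\<close> is given by its quotient map, i.e. a
  surjective ring homomorphism with kernel \<open>(p,q)\<close>.
\<close>

definition ideal2 :: "'a::comm_ring_1 \<Rightarrow> 'a \<Rightarrow> 'a set" where
  "ideal2 p q = {a * p + b * q | a b. True}"

definition prime_ideal2 :: "'a::comm_ring_1 \<Rightarrow> 'a \<Rightarrow> bool" where
  "prime_ideal2 p q \<longleftrightarrow>
     1 \<notin> ideal2 p q \<and> (\<forall>a b. a * b \<in> ideal2 p q \<longrightarrow> a \<in> ideal2 p q \<or> b \<in> ideal2 p q)"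

definition quotient_map :: "('f::field poly poly \<Rightarrow> 'r::comm_ring_1) \<Rightarrow> 'f poly poly \<Rightarrow> 'f poly poly \<Rightarrow> bool" where
  "quotient_map \<pi> p q \<longleftrightarrow>
     \<pi> 1 = 1 \<and> (\<forall>a b. \<pi> (a + b) = \<pi> a + \<pi> b) \<and> (\<forall>a b. \<pi> (a * b) = \<pi> a * \<pi> b) \<and>
     surj \<pi> \<and> {a. \<pi> a = 0} = ideal2 p q"


section \<open>Closed braids and their resolutions\<close>

text \<open>
  Braids run upwards and are closed by strands running down on the right, so that strand \<open>1\<close> (the
  leftmost) becomes the outermost and strand \<open>n\<close> the innermost loop of the closure of an \<open>n\<close>-braid.
  The letters \<open>Pos i\<close> and \<open>Neg i\<close> are \<open>\<sigma>\<^sub>i\<close> and its inverse, crossing the strands \<open>i\<close> and \<open>i + 1\<close>.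
\<close>

datatype letter = Pos (idx: nat) | Neg (idx: nat)

abbreviation is_Neg :: "letter \<Rightarrow> bool" where
  "is_Neg c \<equiv> (case c of Pos _ \<Rightarrow> False | Neg _ \<Rightarrow> True)"

definition braid :: "nat \<Rightarrow> letter list \<Rightarrow> bool" where
  "braid n w \<longleftrightarrow> 1 \<le> n \<and> (\<forall>c\<in>set w. 1 \<le> idx c \<and> idx c < n)"

text \<open>
  A resolution of the closure of \<open>w\<close> is a \<^typ>\<open>bool list\<close> of the length of \<open>w\<close>, \<^const>\<open>True\<close> standing
  for the 1-resolution. Resolving a letter leaves either the trivial braid (\<open>Vert\<close>) or a cup
  above a cap joining the strands \<open>i\<close> and \<open>i + 1\<close> (\<open>Cupcap i\<close>): for an upward \<open>\<sigma>\<^sub>i\<close> the over-strand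
  runs from SW to NE, and for its inverse the picture is rotated by a quarter turn.
\<close>

datatype layer = Vert | Cupcap nat

fun resolve :: "letter \<Rightarrow> bool \<Rightarrow> layer" where
  "resolve (Pos i) b = (if b then Cupcap i else Vert)"
| "resolve (Neg i) b = (if b then Vert else Cupcap i)"

definition layers :: "letter list \<Rightarrow> bool list \<Rightarrow> layer list" where
  "layers w r = map2 resolve w r"

definition oriented :: "letter list \<Rightarrow> bool list" where
  "oriented w = map is_Neg w"

definition n_minus :: "letter list \<Rightarrow> nat" where
  "n_minus w = length (filter is_Neg w)"

text \<open>
  A closed stack of layers on \<open>n\<close> strands is recorded by its intersection points \<open>(k, j)\<close> with the
  horizontal lines separating the layers: \<open>k\<close> is the height (layer \<open>k\<close> lies between the heights \<open>k\<close>
  and \<open>k + 1\<close>) and \<open>j\<close> the strand. The closing strands identify the top height with height \<open>0\<close>.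
  A circle is the set of such points on it.
\<close>

type_synonym point = "nat \<times> nat"
type_synonym circle = "point set"

definition points :: "nat \<Rightarrow> layer list \<Rightarrow> point set" where
  "points n fs = {0..length fs} \<times> {1..n}"

fun layer_arcs :: "nat \<Rightarrow> layer \<Rightarrow> (point \<times> point) set" where
  "layer_arcs k Vert = {((k, j), (Suc k, j)) | j. True}"
| "layer_arcs k (Cupcap i) =
     {((k, j), (Suc k, j)) | j. j \<noteq> i \<and> j \<noteq> Suc i} \<union>
     {((k, i), (k, Suc i)), ((Suc k, i), (Suc k, Suc i))}"

definition arcs :: "layer list \<Rightarrow> (point \<times> point) set" where
  "arcs fs = {((0, j), (length fs, j)) | j. True} \<union> (\<Union>k<length fs. layer_arcs k (fs ! k))"

definition circ :: "nat \<Rightarrow> layer list \<Rightarrow> point \<Rightarrow> circle" where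
  "circ n fs p = {q \<in> points n fs. (p, q) \<in> (arcs fs \<union> (arcs fs)\<inverse>)\<^sup>*}"

definition circles :: "nat \<Rightarrow> layer list \<Rightarrow> circle set" where
  "circles n fs = circ n fs ` points n fs"

text \<open>
  The path to infinity from a point of \<open>\<gamma>\<close> pushed to the left is the horizontal one going left; it
  crosses the circles in the points of the same height on strands further left.
\<close>

definition winding :: "nat \<Rightarrow> layer list \<Rightarrow> circle \<Rightarrow> nat" where
  "winding n fs \<gamma> =
     (let (k, j) = (SOME p. p \<in> \<gamma>) in card {j'. (k, j') \<in> \<Union>(circles n fs) \<and> j' < j} mod 2)"

text \<open>\<open>r \<prec> r'\<close> for the resolutions of a diagram with \<open>N\<close> crossings.\<close>

definition precedes :: "nat \<Rightarrow> bool list \<Rightarrow> bool list \<Rightarrow> bool" where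
  "precedes N r r' \<longleftrightarrow> length r = N \<and> (\<exists>k<N. \<not> r ! k \<and> r' = r[k := True])"

definition sign_function :: "nat \<Rightarrow> (bool list \<Rightarrow> bool list \<Rightarrow> int) \<Rightarrow> bool" where
  "sign_function N s \<longleftrightarrow>
     (\<forall>r r'. precedes N r r' \<longrightarrow> s r r' \<in> {1, -1}) \<and>
     (\<forall>r0 r1 r2 r3. precedes N r0 r1 \<and> precedes N r0 r2 \<and> precedes N r1 r3 \<and> precedes N r2 r3 \<and> r1 \<noteq> r2
        \<longrightarrow> s r0 r1 * s r1 r3 = - (s r0 r2 * s r2 r3))"


section \<open>Tensor powers of a free module with basis \<open>1, X\<close>\<close>

text \<open>
  Elements of \<open>A = R[X]/((X - x\<^sub>1)(X - x\<^sub>2))\<close> are represented by the polynomials of degree less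
  than 2. As \<open>A\<close> is free on \<open>1, X\<close>, the tensor product of copies of \<open>A\<close> over a finite set \<open>\<Gamma>\<close> of circles is
  free on \<open>Pow \<Gamma>\<close>, the basis element of \<open>S\<close> having the label \<open>X\<close> on \<open>S\<close> and \<open>1\<close> elsewhere. A
  tensor is its family of coefficients. \<open>pure \<Gamma> \<alpha>\<close> is the enhanced state with labels \<open>\<alpha>\<close>, and
  \<open>linear_ext \<Gamma> F\<close> is the linear map whose value on enhanced states is the (multilinear) \<open>F\<close>.
\<close>

type_synonym 'r tensor = "circle set \<Rightarrow> 'r"
type_synonym 'r labelling = "circle \<Rightarrow> 'r poly"
type_synonym 'r chain = "bool list \<Rightarrow> 'r tensor"

definition tscale :: "'r::comm_ring_1 \<Rightarrow> 'r tensor \<Rightarrow> 'r tensor" where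
  "tscale c t = (\<lambda>S. c * t S)"

definition cscale :: "'r::comm_ring_1 \<Rightarrow> 'r chain \<Rightarrow> 'r chain" where
  "cscale c x = (\<lambda>r. tscale c (x r))"

definition pure :: "circle set \<Rightarrow> 'r::comm_ring_1 labelling \<Rightarrow> 'r tensor" where
  "pure \<Gamma> \<alpha> = (\<lambda>S. if S \<subseteq> \<Gamma> then \<Prod>\<gamma>\<in>\<Gamma>. coeff (\<alpha> \<gamma>) (if \<gamma> \<in> S then 1 else 0) else 0)"

definition linear_ext :: "circle set \<Rightarrow> ('r::comm_ring_1 labelling \<Rightarrow> 'r tensor) \<Rightarrow> 'r tensor \<Rightarrow> 'r tensor" where
  "linear_ext \<Gamma> F t = (\<Sum>S\<in>Pow \<Gamma>. tscale (t S) (F (\<lambda>\<gamma>. if \<gamma> \<in> S then [:0, 1:] else 1)))"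

definition counit :: "'r::comm_ring_1 poly \<Rightarrow> 'r" where
  "counit a = coeff a 1"

text \<open>
  Let two stacks of layers be identified outside some region, \<open>\<rho>\<close> relating points \<open>p\<close> of the first with
  the points of the second on the corresponding circle. A labelling of the first stack is carried
  to those circles of the second one that contain a related point.
\<close>

definition carry :: "nat \<Rightarrow> layer list \<Rightarrow> (point \<times> point) set \<Rightarrow> 'r labelling \<Rightarrow> 'r labelling" where
  "carry n fs \<rho> \<alpha> = (\<lambda>\<gamma>'. \<alpha> (circ n fs (SOME p. p \<in> points n fs \<and> (\<exists>q\<in>\<gamma>'. (p, q) \<in> \<rho>))))"

definition transport ::
    "nat \<Rightarrow> layer list \<Rightarrow> nat \<Rightarrow> layer list \<Rightarrow> (point \<times> point) set \<Rightarrow> 'r::comm_ring_1 tensor \<Rightarrow> 'r tensor" where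
  "transport n fs n' fs' \<rho> =
     linear_ext (circles n fs) (\<lambda>\<alpha>. pure (circles n' fs') (carry n fs \<rho> \<alpha>))"

text \<open>\<open>birth\<close> labels the new circle \<open>\<gamma>\<close> of the second stack by \<open>1\<close>; \<open>death\<close> applies the counit to the
  label of the circle \<open>\<gamma>\<close> of the first stack, which is then removed.\<close>

definition birth ::
    "nat \<Rightarrow> layer list \<Rightarrow> nat \<Rightarrow> layer list \<Rightarrow> (point \<times> point) set \<Rightarrow> circle \<Rightarrow> 'r::comm_ring_1 tensor \<Rightarrow> 'r tensor" where
  "birth n fs n' fs' \<rho> \<gamma> =
     linear_ext (circles n fs) (\<lambda>\<alpha>. pure (circles n' fs') ((carry n fs \<rho> \<alpha>)(\<gamma> := 1)))"

definition death ::
    "nat \<Rightarrow> layer list \<Rightarrow> nat \<Rightarrow> layer list \<Rightarrow> (point \<times> point) set \<Rightarrow> circle \<Rightarrow> 'r::comm_ring_1 tensor \<Rightarrow> 'r tensor" where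
  "death n fs n' fs' \<rho> \<gamma> =
     linear_ext (circles n fs)
       (\<lambda>\<alpha>. tscale (counit (\<alpha> \<gamma>)) (pure (circles n' fs') (carry n fs \<rho> \<alpha>)))"

text \<open>Points of a stack and of the stack with \<open>m\<close> further layers inserted at height \<open>a\<close>.\<close>

definition insertion :: "nat \<Rightarrow> nat \<Rightarrow> (point \<times> point) set" where
  "insertion a m = {((k, j), (if k \<le> a then k else k + m, j)) | k j. True}"

text \<open>
  Points of a stack of height \<open>N\<close> and of the stack in which the first \<open>a\<close> layers have been moved
  around the closure to the top.
\<close>

definition rotation :: "nat \<Rightarrow> nat \<Rightarrow> (point \<times> point) set" where
  "rotation a N =
     {((k, j), (k - a, j)) | k j. a \<le> k \<and> k \<le> N} \<union> {((k, j), (k + N - a, j)) | k j. k \<le> a}"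

text \<open>Stacks that differ only between two heights: the points off the heights in \<open>K\<close> agree.\<close>

definition off_heights :: "nat set \<Rightarrow> (point \<times> point) set" where
  "off_heights K = {((k, j), (k, j)) | k j. k \<notin> K}"


section \<open>The complex\<close>

definition chains :: "nat \<Rightarrow> letter list \<Rightarrow> 'r::comm_ring_1 chain set" where
  "chains n w = {x. \<forall>r S. x r S \<noteq> 0 \<longrightarrow> length r = length w \<and> S \<subseteq> circles n (layers w r)}"

definition chains_deg :: "nat \<Rightarrow> letter list \<Rightarrow> int \<Rightarrow> 'r::comm_ring_1 chain set" where
  "chains_deg n w i =
     {x \<in> chains n w. \<forall>r. x r \<noteq> 0 \<longrightarrow> int (length (filter id r)) - int (n_minus w) = i}"

definition signs :: "(bool list \<Rightarrow> int) \<Rightarrow> bool" where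
  "signs \<eta> \<longleftrightarrow> (\<forall>r. \<eta> r \<in> {1, -1})"

definition oriented_signs :: "letter list \<Rightarrow> (bool list \<Rightarrow> int) \<Rightarrow> bool" where
  "oriented_signs w \<eta> \<longleftrightarrow> signs \<eta> \<and> \<eta> (oriented w) = 1"

context
  fixes x1 x2 :: "'r::comm_ring_1"
begin

definition x_white :: "'r poly" where "x_white = [:- x1, 1:]"
definition x_black :: "'r poly" where "x_black = [:- x2, 1:]"

definition reduce :: "'r poly \<Rightarrow> 'r poly" where
  "reduce f = (THE g. degree g < 2 \<and> x_white * x_black dvd f - g)"

definition mult :: "'r poly \<Rightarrow> 'r poly \<Rightarrow> 'r poly" where
  "mult a b = reduce (a * b)"

text \<open>The coproduct \<open>aX \<otimes> 1 + a \<otimes> X - (x\<^sub>1 + x\<^sub>2) a \<otimes> 1\<close> as a list of elementary tensors to be added up.\<close>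

definition comult :: "'r poly \<Rightarrow> ('r poly \<times> 'r poly) list" where
  "comult a = [(mult a [:0, 1:], 1), (a, [:0, 1:]), (smult (- (x1 + x2)) a, 1)]"

text \<open>
  The saddle between stacks that differ in layer \<open>k\<close> only, one of them having \<open>Vert\<close> and the other
  \<open>Cupcap i\<close> there. The points \<open>a\<close> and \<open>b\<close> lie on the two local arcs of either layer. All circles
  avoiding the layer are the same sets of points before and after.
\<close>

definition saddle :: "nat \<Rightarrow> layer list \<Rightarrow> layer list \<Rightarrow> nat \<Rightarrow> nat \<Rightarrow> 'r tensor \<Rightarrow> 'r tensor" where
  "saddle n fs fs' k i =
     (let a = (k, i); b = (Suc k, Suc i); \<gamma> = circ n fs; \<gamma>' = circ n fs' in
      linear_ext (circles n fs) (\<lambda>\<alpha>.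
        if \<gamma> a \<noteq> \<gamma> b
        then pure (circles n fs') (\<alpha>(\<gamma>' a := mult (\<alpha> (\<gamma> a)) (\<alpha> (\<gamma> b))))
        else (\<Sum>(p, q)\<leftarrow>comult (\<alpha> (\<gamma> a)). pure (circles n fs') (\<alpha>(\<gamma>' a := p, \<gamma>' b := q)))))"

text \<open>The part of the differential coming from the crossing \<open>k\<close>.\<close>

definition diff_at ::
    "nat \<Rightarrow> letter list \<Rightarrow> (bool list \<Rightarrow> bool list \<Rightarrow> int) \<Rightarrow> nat \<Rightarrow> 'r chain \<Rightarrow> 'r chain" where
  "diff_at n w s k x = (\<lambda>r'. if length r' = length w \<and> r' ! k
     then (let r = r'[k := False] in
           tscale (of_int (s r r')) (saddle n (layers w r) (layers w r') k (idx (w ! k)) (x r)))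
     else 0)"

definition diff :: "nat \<Rightarrow> letter list \<Rightarrow> (bool list \<Rightarrow> bool list \<Rightarrow> int) \<Rightarrow> 'r chain \<Rightarrow> 'r chain" where
  "diff n w s x = (\<Sum>k<length w. diff_at n w s k x)"

definition beta :: "nat \<Rightarrow> letter list \<Rightarrow> 'r chain" where
  "beta n w = (\<lambda>r. if r = oriented w
     then let fs = layers w r in
          pure (circles n fs) (\<lambda>\<gamma>. if winding n fs \<gamma> = 0 then x_white else x_black)
     else 0)"

definition beta_bar :: "nat \<Rightarrow> letter list \<Rightarrow> 'r chain" where
  "beta_bar n w = (\<lambda>r. if r = oriented w
     then let fs = layers w r in
          pure (circles n fs) (\<lambda>\<gamma>. if winding n fs \<gamma> = 0 then x_black else x_white)
     else 0)"

definition chain_map ::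
    "nat \<Rightarrow> letter list \<Rightarrow> (bool list \<Rightarrow> bool list \<Rightarrow> int) \<Rightarrow>
     nat \<Rightarrow> letter list \<Rightarrow> (bool list \<Rightarrow> bool list \<Rightarrow> int) \<Rightarrow> ('r chain \<Rightarrow> 'r chain) \<Rightarrow> bool" where
  "chain_map n w s n' w' s' \<Phi> \<longleftrightarrow> (\<forall>x\<in>chains n w. \<Phi> (diff n w s x) = diff n' w' s' (\<Phi> x))"


section \<open>Maps of the moves\<close>

text \<open>
  Each of the following maps depends on a family \<open>\<eta>\<close> of signs, one for each component. It subsumes
  the identification of complexes built from different sign functions and the signs in the maps
  of the moves; it will be fixed by the requirements that the result be a chain map and
  that the sign be \<open>+\<close> on the oriented resolution.
\<close>

text \<open>Planar isotopies: conjugation \<open>u @ v \<mapsto> v @ u\<close>, and interchange of distant letters in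
  \<open>u @ [c, c'] @ v\<close>.\<close>

definition conj_map :: "nat \<Rightarrow> letter list \<Rightarrow> letter list \<Rightarrow> (bool list \<Rightarrow> int) \<Rightarrow> 'r chain \<Rightarrow> 'r chain" where
  "conj_map n u v \<eta> x = (\<lambda>r'. if length r' = length (v @ u)
     then let r = drop (length v) r' @ take (length v) r' in
          tscale (of_int (\<eta> r'))
            (transport n (layers (u @ v) r) n (layers (v @ u) r')
               (rotation (length u) (length (u @ v))) (x r))
     else 0)"

definition far_map ::
    "nat \<Rightarrow> letter list \<Rightarrow> letter \<Rightarrow> letter \<Rightarrow> letter list \<Rightarrow> (bool list \<Rightarrow> int) \<Rightarrow> 'r chain \<Rightarrow> 'r chain" where
  "far_map n u c c' v \<eta> x = (\<lambda>r'. if length r' = length (u @ [c', c] @ v)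
     then let a = length u; r = r'[a := r' ! Suc a, Suc a := r' ! a] in
          tscale (of_int (\<eta> r'))
            (transport n (layers (u @ [c, c'] @ v) r) n (layers (u @ [c', c] @ v) r')
               (off_heights {Suc a}) (x r))
     else 0)"

text \<open>
  Second move between \<open>u @ v\<close> and \<open>u @ [c, c'] @ v\<close>, where \<open>c\<close>, \<open>c'\<close> are \<open>\<sigma>\<^sub>i\<close> and its inverse in
  either order. The resolution of \<open>c\<close> and \<open>c'\<close> giving back \<open>u @ v\<close> is the oriented one, and the
  opposite one is the one with the small circle \<open>\<gamma>''\<close>. \<open>arc_e\<close> and \<open>arc_g\<close> are
  \<open>S(\<cdot>, e) \<otimes> \<iota>(1)\<close> and \<open>S(\<cdot>, g)\<close> after the counit, both on the resolutions with layers \<open>fu\<close> and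
  \<open>fv\<close> around the new ones.
\<close>

definition small_circle :: "nat \<Rightarrow> layer list \<Rightarrow> nat \<Rightarrow> layer list \<Rightarrow> circle" where
  "small_circle n fu i fv = circ n (fu @ [Cupcap i, Cupcap i] @ fv) (Suc (length fu), i)"

definition arc_e :: "nat \<Rightarrow> layer list \<Rightarrow> nat \<Rightarrow> layer list \<Rightarrow> 'r tensor \<Rightarrow> 'r tensor" where
  "arc_e n fu i fv t =
     (let a = length fu; \<rho> = insertion a 1;
          f0 = fu @ fv; f1 = fu @ [Vert] @ fv; f2 = fu @ [Cupcap i] @ fv;
          f3 = fu @ [Cupcap i, Cupcap i] @ fv in
      birth n f2 n f3 \<rho> (small_circle n fu i fv) (saddle n f1 f2 a i (transport n f0 n f1 \<rho> t)))"

definition arc_g :: "nat \<Rightarrow> layer list \<Rightarrow> nat \<Rightarrow> layer list \<Rightarrow> 'r tensor \<Rightarrow> 'r tensor" where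
  "arc_g n fu i fv t =
     (let a = length fu; \<rho> = (insertion a 1)\<inverse>;
          f0 = fu @ fv; f1 = fu @ [Vert] @ fv; f2 = fu @ [Cupcap i] @ fv;
          f3 = fu @ [Cupcap i, Cupcap i] @ fv in
      transport n f1 n f0 \<rho> (saddle n f2 f1 a i (death n f3 n f2 \<rho> (small_circle n fu i fv) t)))"

definition r2_pair :: "letter \<Rightarrow> letter \<Rightarrow> bool" where
  "r2_pair c c' \<longleftrightarrow> idx c = idx c' \<and> is_Neg c \<noteq> is_Neg c'"

definition psi2 ::
    "nat \<Rightarrow> letter list \<Rightarrow> letter \<Rightarrow> letter \<Rightarrow> letter list \<Rightarrow> (bool list \<Rightarrow> int) \<Rightarrow> 'r chain \<Rightarrow> 'r chain" where
  "psi2 n u c c' v \<eta> x = (\<lambda>r'. if length r' = length (u @ [c, c'] @ v)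
     then let a = length u; ru = take a r'; rv = drop (Suc (Suc a)) r';
              b = r' ! a; b' = r' ! Suc a; r = ru @ rv in
          tscale (of_int (\<eta> r'))
            (if b = is_Neg c \<and> b' = is_Neg c'
             then transport n (layers (u @ v) r) n (layers (u @ [c, c'] @ v) r') (insertion a 2) (x r)
             else if b \<noteq> is_Neg c \<and> b' \<noteq> is_Neg c'
             then arc_e n (layers u ru) (idx c) (layers v rv) (x r)
             else 0)
     else 0)"

definition phi2 ::
    "nat \<Rightarrow> letter list \<Rightarrow> letter \<Rightarrow> letter \<Rightarrow> letter list \<Rightarrow> (bool list \<Rightarrow> int) \<Rightarrow> 'r chain \<Rightarrow> 'r chain" where
  "phi2 n u c c' v \<eta> x = (\<lambda>r. if length r = length (u @ v)
     then let a = length u; ru = take a r; rv = drop a r;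
              r10 = ru @ [is_Neg c, is_Neg c'] @ rv; r01 = ru @ [\<not> is_Neg c, \<not> is_Neg c'] @ rv in
          tscale (of_int (\<eta> r10))
            (transport n (layers (u @ [c, c'] @ v) r10) n (layers (u @ v) r) ((insertion a 2)\<inverse>) (x r10)) +
          tscale (of_int (\<eta> r01))
            (arc_g n (layers u ru) (idx c) (layers v rv) (x r01))
     else 0)"

definition psi2_map where
  "psi2_map n u c c' v s s' \<Psi> \<longleftrightarrow>
     (\<exists>\<eta>. oriented_signs (u @ [c, c'] @ v) \<eta> \<and> \<Psi> = psi2 n u c c' v \<eta>) \<and>
     chain_map n (u @ v) s n (u @ [c, c'] @ v) s' \<Psi>"

definition phi2_map where
  "phi2_map n u c c' v s s' \<Phi> \<longleftrightarrow>
     (\<exists>\<eta>. oriented_signs (u @ [c, c'] @ v) \<eta> \<and> \<Phi> = phi2 n u c c' v \<eta>) \<and>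
     chain_map n (u @ [c, c'] @ v) s n (u @ v) s' \<Phi>"

text \<open>
  A homotopy \<open>h\<close> on the complex of \<open>w\<close> with \<open>f g = id\<close>, \<open>g f - id = d h + h d\<close>, \<open>h g = 0\<close>, for
  \<open>f\<close> to and \<open>g\<close> from the complex of \<open>w''\<close>.
\<close>

definition retraction_homotopy ::
    "nat \<Rightarrow> letter list \<Rightarrow> (bool list \<Rightarrow> bool list \<Rightarrow> int) \<Rightarrow> letter list \<Rightarrow>
     ('r chain \<Rightarrow> 'r chain) \<Rightarrow> ('r chain \<Rightarrow> 'r chain) \<Rightarrow> ('r chain \<Rightarrow> 'r chain) \<Rightarrow> bool" where
  "retraction_homotopy n w s w'' f g h \<longleftrightarrow>
     (\<forall>i. \<forall>x\<in>chains_deg n w i. h x \<in> chains_deg n w (i - 1)) \<and>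
     (\<forall>x\<in>chains n w. \<forall>y\<in>chains n w. h (x + y) = h x + h y) \<and>
     (\<forall>c. \<forall>x\<in>chains n w. h (cscale c x) = cscale c (h x)) \<and>
     (\<forall>y\<in>chains n w''. f (g y) = y) \<and>
     (\<forall>x\<in>chains n w. g (f x) - x = diff n w s (h x) + h (diff n w s x)) \<and>
     (\<forall>y\<in>chains n w''. h (g y) = 0)"

text \<open>
  Third moves. Let \<open>c\<close> be a positive crossing at position \<open>k\<close> of \<open>w\<close>, so that 0-resolving it amounts to
  deleting the letter. The complex of \<open>w\<close> is the cone of \<open>S = diff_at n w s k\<close> from
  the part with \<open>c\<close> 0-resolved, which is identified by \<open>part0\<close> and \<open>incl0\<close> with the complex of the
  word without \<open>c\<close> (with sign function \<open>sign0 k s\<close>), to the part \<open>part1\<close> with \<open>c\<close> 1-resolved.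
\<close>

definition delete_at :: "nat \<Rightarrow> 'a list \<Rightarrow> 'a list" where
  "delete_at k xs = take k xs @ drop (Suc k) xs"

definition insert_at :: "nat \<Rightarrow> 'a \<Rightarrow> 'a list \<Rightarrow> 'a list" where
  "insert_at k a xs = take k xs @ [a] @ drop k xs"

definition sign0 :: "nat \<Rightarrow> (bool list \<Rightarrow> bool list \<Rightarrow> int) \<Rightarrow> bool list \<Rightarrow> bool list \<Rightarrow> int" where
  "sign0 k s r r' = s (insert_at k False r) (insert_at k False r')"

definition part0 :: "nat \<Rightarrow> letter list \<Rightarrow> nat \<Rightarrow> 'r chain \<Rightarrow> 'r chain" where
  "part0 n w k x = (\<lambda>r0. if Suc (length r0) = length w
     then let r = insert_at k False r0 in
          transport n (layers w r) n (layers (delete_at k w) r0) ((insertion k 1)\<inverse>) (x r)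
     else 0)"

definition incl0 :: "nat \<Rightarrow> letter list \<Rightarrow> nat \<Rightarrow> 'r chain \<Rightarrow> 'r chain" where
  "incl0 n w k y = (\<lambda>r. if length r = length w \<and> \<not> r ! k
     then let r0 = delete_at k r in
          transport n (layers (delete_at k w) r0) n (layers w r) (insertion k 1) (y r0)
     else 0)"

definition part1 :: "nat \<Rightarrow> letter list \<Rightarrow> nat \<Rightarrow> 'r chain \<Rightarrow> 'r chain" where
  "part1 n w k x = (\<lambda>r. if length r = length w \<and> r ! k then x r else 0)"

text \<open>The differential of \<open>Cone(S g)\<close>, where \<open>g\<close> starts from the complex of \<open>w''\<close> with sign function \<open>s''\<close>.\<close>

definition cone_diff ::
    "nat \<Rightarrow> letter list \<Rightarrow> (bool list \<Rightarrow> bool list \<Rightarrow> int) \<Rightarrow> nat \<Rightarrow> letter list \<Rightarrow>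
     (bool list \<Rightarrow> bool list \<Rightarrow> int) \<Rightarrow> ('r chain \<Rightarrow> 'r chain) \<Rightarrow> 'r chain \<times> 'r chain \<Rightarrow> 'r chain \<times> 'r chain" where
  "cone_diff n w s k w'' s'' g = (\<lambda>(x, y).
     (diff n w'' s'' x, diff_at n w s k (incl0 n w k (g x)) + diff n w s y))"

text \<open>\<open>(x, y) \<mapsto> (f x, y \<plusminus> S h x)\<close>, the sign being \<open>\<kappa>\<close>, and \<open>(x, y) \<mapsto> (g x, y)\<close>.\<close>

definition to_cone where
  "to_cone n w s k f h \<kappa> x =
     (f (part0 n w k x),
      part1 n w k x + cscale (of_int \<kappa>) (diff_at n w s k (incl0 n w k (h (part0 n w k x)))))"

definition from_cone :: "nat \<Rightarrow> letter list \<Rightarrow> nat \<Rightarrow> ('r chain \<Rightarrow> 'r chain) \<Rightarrow> 'r chain \<times> 'r chain \<Rightarrow> 'r chain" where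
  "from_cone n w k g = (\<lambda>(x, y). incl0 n w k (g x) + y)"

text \<open>
  The planar isotopy between the 1-resolutions of the middle crossings of
  \<open>u @ [c\<^sub>1, c, c\<^sub>2] @ v\<close> and \<open>u @ [c'\<^sub>1, c', c'\<^sub>2] @ v\<close>, which matches the first and the last of the three crossings
  of the two words and is the identity outside of the three layers.
\<close>

definition top_iso :: "nat \<Rightarrow> letter list \<Rightarrow> letter list \<Rightarrow> nat \<Rightarrow> (bool list \<Rightarrow> int) \<Rightarrow> 'r chain \<Rightarrow> 'r chain" where
  "top_iso n w w' k \<eta> y = (\<lambda>r. if length r = length w' \<and> r ! k
     then tscale (of_int (\<eta> r))
            (transport n (layers w r) n (layers w' r) (off_heights {k, Suc k}) (y r))
     else 0)"

text \<open>
  The two sides of the move, \<open>\<sigma>\<^sub>i\<^sub>+\<^sub>1\<^sup>-\<^sup>1 \<sigma>\<^sub>i \<sigma>\<^sub>i\<^sub>+\<^sub>1\<close> and \<open>\<sigma>\<^sub>i \<sigma>\<^sub>i\<^sub>+\<^sub>1 \<sigma>\<^sub>i\<^sup>-\<^sup>1\<close>, as triples of letters. The map from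
  either side to the other is defined in the same way, so the predicate \<open>r3_map\<close> covers both
  \<open>\<Psi>\<^sub>3\<close> and \<open>\<Phi>\<^sub>3\<close>.
\<close>

definition r3_sides :: "letter \<times> letter \<times> letter \<Rightarrow> letter \<times> letter \<times> letter \<Rightarrow> bool" where
  "r3_sides t t' \<longleftrightarrow> (\<exists>i. {t, t'} =
     {(Neg (Suc i), Pos i, Pos (Suc i)), (Pos i, Pos (Suc i), Neg i)})"

definition r3_map where
  "r3_map n u t t' v s s' \<Psi> \<longleftrightarrow>
     (\<exists>c1 c c2 c1' c' c2' s'' f g h g0 \<kappa> \<eta>.
        t = (c1, c, c2) \<and> t' = (c1', c', c2') \<and>
        (let w = u @ [c1, c, c2] @ v; w' = u @ [c1', c', c2'] @ v; k = Suc (length u);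
             w'' = u @ v; \<Theta> = top_iso n w w' k \<eta> in
         sign_function (length w'') s'' \<and>
         phi2_map n u c1 c2 v (sign0 k s) s'' f \<and>
         psi2_map n u c1 c2 v s'' (sign0 k s) g \<and>
         psi2_map n u c1' c2' v s'' (sign0 k s') g0 \<and>
         retraction_homotopy n (delete_at k w) (sign0 k s) w'' f g h \<and>
         \<kappa> \<in> {1, -1} \<and>
         (\<forall>x\<in>chains n w.
            to_cone n w s k f h \<kappa> (diff n w s x) = cone_diff n w s k w'' s'' g (to_cone n w s k f h \<kappa> x)) \<and>
         signs \<eta> \<and>
         (\<forall>x\<in>chains n w''. \<forall>y\<in>chains n w. part1 n w k y = y \<longrightarrow>
            map_prod id \<Theta> (cone_diff n w s k w'' s'' g (x, y)) =
            cone_diff n w' s' k w'' s'' g0 (x, \<Theta> y)) \<and>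
         \<Psi> = (\<lambda>x. from_cone n w' k g0 (map_prod id \<Theta> (to_cone n w s k f h \<kappa> x)))))"

text \<open>
  Stabilizations. The new crossing is the last letter and involves the new innermost strand \<open>n + 1\<close>;
  its vertical resolution is the old diagram together with the closed strand \<open>n + 1\<close>.
\<close>

definition new_circle :: "nat \<Rightarrow> layer list \<Rightarrow> circle" where
  "new_circle n fs' = circ (Suc n) fs' (0, Suc n)"

definition phi1_pos :: "nat \<Rightarrow> letter list \<Rightarrow> (bool list \<Rightarrow> int) \<Rightarrow> 'r chain \<Rightarrow> 'r chain" where
  "phi1_pos n w \<eta> x = (\<lambda>r'. if length r' = Suc (length w) \<and> \<not> last r'
     then let r = butlast r'; fs = layers w r; fs' = layers (w @ [Pos n]) r';
              \<Gamma>' = circles (Suc n) fs'; \<gamma> = circ n fs (0, n); \<gamma>' = circ (Suc n) fs' (0, n) in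
          tscale (of_int (\<eta> r'))
            (linear_ext (circles n fs) (\<lambda>\<alpha>. let \<alpha>' = carry n fs Id \<alpha> in
               pure \<Gamma>' (\<alpha>'(new_circle n fs' := x_white + x_black)) -
               (\<Sum>(p, q)\<leftarrow>comult (\<alpha> \<gamma>). pure \<Gamma>' (\<alpha>'(\<gamma>' := p, new_circle n fs' := q)))) (x r))
     else 0)"

definition psi1_pos :: "nat \<Rightarrow> letter list \<Rightarrow> (bool list \<Rightarrow> int) \<Rightarrow> 'r chain \<Rightarrow> 'r chain" where
  "psi1_pos n w \<eta> x = (\<lambda>r. if length r = length w
     then let r' = r @ [False]; fs = layers w r; fs' = layers (w @ [Pos n]) r' in
          tscale (of_int (\<eta> r)) (death (Suc n) fs' n fs Id (new_circle n fs') (x r'))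
     else 0)"

definition phi1_neg :: "nat \<Rightarrow> letter list \<Rightarrow> (bool list \<Rightarrow> int) \<Rightarrow> 'r chain \<Rightarrow> 'r chain" where
  "phi1_neg n w \<eta> x = (\<lambda>r'. if length r' = Suc (length w) \<and> last r'
     then let r = butlast r'; fs = layers w r; fs' = layers (w @ [Neg n]) r' in
          tscale (of_int (\<eta> r')) (birth n fs (Suc n) fs' Id (new_circle n fs') (x r))
     else 0)"


section \<open>Markov moves\<close>

text \<open>
  \<open>transverse_map (n, w, s) (n', w', s') \<Phi>\<close>: \<open>\<Phi>\<close> is the map, between the complexes of the closures
  built with the sign functions \<open>s\<close> and \<open>s'\<close>, of a sequence of transverse Markov moves from \<open>w\<close> to
  \<open>w'\<close>. The braid relations are generated by insertion and cancellation of
  \<open>\<sigma>\<^sub>i \<sigma>\<^sub>i\<^sup>-\<^sup>1\<close> and \<open>\<sigma>\<^sub>i\<^sup>-\<^sup>1 \<sigma>\<^sub>i\<close>, interchange of distant letters, and the basic third move; e.g.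
  \<open>\<sigma>\<^sub>1\<sigma>\<^sub>2\<sigma>\<^sub>1 \<mapsto> \<sigma>\<^sub>2(\<sigma>\<^sub>2\<^sup>-\<^sup>1\<sigma>\<^sub>1\<sigma>\<^sub>2)\<sigma>\<^sub>1 \<mapsto> \<sigma>\<^sub>2(\<sigma>\<^sub>1\<sigma>\<^sub>2\<sigma>\<^sub>1\<^sup>-\<^sup>1)\<sigma>\<^sub>1 \<mapsto> \<sigma>\<^sub>2\<sigma>\<^sub>1\<sigma>\<^sub>2\<close>. Conjugation is generated by
  insertions and cancellations together with the cyclic permutations \<open>u @ v \<mapsto> v @ u\<close>. For \<open>u = []\<close>
  the rule \<open>conjugation\<close> is a mere change of the sign function.
\<close>

inductive transverse_map ::
    "nat \<times> letter list \<times> (bool list \<Rightarrow> bool list \<Rightarrow> int) \<Rightarrow>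
     nat \<times> letter list \<times> (bool list \<Rightarrow> bool list \<Rightarrow> int) \<Rightarrow> ('r chain \<Rightarrow> 'r chain) \<Rightarrow> bool" where
  conjugation:
    "\<lbrakk>braid n (u @ v); sign_function (length (u @ v)) s; sign_function (length (v @ u)) s';
      oriented_signs (v @ u) \<eta>; chain_map n (u @ v) s n (v @ u) s' (conj_map n u v \<eta>)\<rbrakk>
     \<Longrightarrow> transverse_map (n, u @ v, s) (n, v @ u, s') (conj_map n u v \<eta>)"
| far_commutation:
    "\<lbrakk>w = u @ [c, c'] @ v; w' = u @ [c', c] @ v; braid n w;
      idx c + 2 \<le> idx c' \<or> idx c' + 2 \<le> idx c;
      sign_function (length w) s; sign_function (length w') s';
      oriented_signs w' \<eta>; chain_map n w s n w' s' (far_map n u c c' v \<eta>)\<rbrakk>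
     \<Longrightarrow> transverse_map (n, w, s) (n, w', s') (far_map n u c c' v \<eta>)"
| insertion:
    "\<lbrakk>w = u @ v; w' = u @ [c, c'] @ v; r2_pair c c'; braid n w';
      sign_function (length w) s; sign_function (length w') s'; psi2_map n u c c' v s s' \<Psi>\<rbrakk>
     \<Longrightarrow> transverse_map (n, w, s) (n, w', s') \<Psi>"
| cancellation:
    "\<lbrakk>w = u @ [c, c'] @ v; w' = u @ v; r2_pair c c'; braid n w;
      sign_function (length w) s; sign_function (length w') s'; phi2_map n u c c' v s s' \<Phi>\<rbrakk>
     \<Longrightarrow> transverse_map (n, w, s) (n, w', s') \<Phi>"
| third_move:
    "\<lbrakk>w = u @ [c1, c, c2] @ v; w' = u @ [c1', c', c2'] @ v;
      r3_sides (c1, c, c2) (c1', c', c2'); braid n w;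
      sign_function (length w) s; sign_function (length w') s';
      r3_map n u (c1, c, c2) (c1', c', c2') v s s' \<Psi>\<rbrakk>
     \<Longrightarrow> transverse_map (n, w, s) (n, w', s') \<Psi>"
| positive_stabilization:
    "\<lbrakk>braid n w; w' = w @ [Pos n]; sign_function (length w) s; sign_function (length w') s';
      oriented_signs w' \<eta>; chain_map n w s (Suc n) w' s' (phi1_pos n w \<eta>)\<rbrakk>
     \<Longrightarrow> transverse_map (n, w, s) (Suc n, w', s') (phi1_pos n w \<eta>)"
| positive_destabilization:
    "\<lbrakk>braid n w; w' = w @ [Pos n]; sign_function (length w) s; sign_function (length w') s';
      oriented_signs w \<eta>; chain_map (Suc n) w' s' n w s (psi1_pos n w \<eta>)\<rbrakk>
     \<Longrightarrow> transverse_map (Suc n, w', s') (n, w, s) (psi1_pos n w \<eta>)"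
| empty_sequence:
    "\<lbrakk>braid n w; sign_function (length w) s\<rbrakk> \<Longrightarrow> transverse_map (n, w, s) (n, w, s) (\<lambda>x. x)"
| composition:
    "\<lbrakk>transverse_map D D' \<Phi>; transverse_map D' D'' \<Phi>'\<rbrakk> \<Longrightarrow> transverse_map D D'' (\<lambda>x. \<Phi>' (\<Phi> x))"

definition negative_stabilization_map ::
    "nat \<Rightarrow> letter list \<Rightarrow> (bool list \<Rightarrow> bool list \<Rightarrow> int) \<Rightarrow> (bool list \<Rightarrow> bool list \<Rightarrow> int) \<Rightarrow>
     ('r chain \<Rightarrow> 'r chain) \<Rightarrow> bool" where
  "negative_stabilization_map n w s s' \<Phi> \<longleftrightarrow>
     (\<exists>\<eta>. oriented_signs (w @ [Neg n]) \<eta> \<and> \<Phi> = phi1_neg n w \<eta>) \<and>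
     chain_map n w s (Suc n) (w @ [Neg n]) s' \<Phi>"

end

end

theory Submission
  imports Defs
begin

text \<open>
  Write \<open>a \<in> {X - x\<^sub>1, X - x\<^sub>2}\<close> and let \<open>b\<close> be the other of the two labels (the labels are \<^emph>\<open>opposite\<close>).
  Everything rests on three identities in the Frobenius algebra: \<open>a b = 0\<close>,
  \<open>\<Delta>(a) = a \<otimes> a\<close>, and \<open>\<epsilon>(a) = 1\<close>.
  
  The oriented resolution of a closed braid resolves every crossing vertically, so its
  circles are the strands, nested in one another, and the beta-cycles label them alternately by the two
  opposite labels. Hence every saddle out of the oriented resolution merges two neighbouring strands,
  which carry opposite labels, and gives \<open>a b = 0\<close>: the beta-cycles are cycles (\<open>diff_strand_chain\<close>).
  
  For the same reason the saddle term of the map of a second move vanishes on a beta-cycle, and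
  the cancelling map only sees the other, oriented, term; planar isotopies and the remaining terms
  carry strands to strands. A positive stabilization labels the new strand by
  \<open>a \<otimes> (a + b) - \<Delta>(a) = a \<otimes> b\<close>, with \<open>a\<close> the label of the old innermost strand,
  and its inverse applies \<open>\<epsilon>\<close> to the label of the innermost strand. For a third move the homotopy \<open>h\<close> seems to be
  uncontrolled, but the relevant beta-cycle of the diagram \<open>D\<^sub>0\<close> is \<open>g\<close> of the beta-cycle of
  the smaller diagram, and \<open>h g = 0\<close>; what is left are the maps of second moves (\<open>r3_map_strands\<close>).
  So all transverse moves preserve beta-cycles on the nose (\<open>transverse_map_strands\<close>).
  
  A negative stabilization labels the new strand by \<open>1\<close>. With \<open>a = X - y\<close> and \<open>b = X - z\<close> one has
  \<open>(y - z) (a \<otimes> 1) = a \<otimes> b - a \<otimes> a\<close>, the first term being the new beta-cycle. The second one is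
  \<open>\<Delta>(a)\<close>, the image of the state in which the new crossing has the other resolution, which fuses the
  two innermost strands into one circle, labelled \<open>a\<close>. All other components of the differential of
  that state merge neighbouring circles with opposite labels, so it is a boundary
  (\<open>diff_capped\<close>, \<open>negative_stabilization_strands\<close>).
  
  The two beta-cycles are treated together, as one family of labels \<open>f j\<close> of the strands \<open>j\<close>
  of which consecutive ones are opposite.
\<close>

section \<open>Multilinear maps on enhanced states\<close>

lemma tscale_apply: "tscale c t S = c * t S"
  by (simp add: tscale_def)

lemma tscale_simps [simp]:
  "tscale c (0 :: 'r::comm_ring_1 tensor) = 0" "tscale 1 t = t" "tscale 0 t = 0"
  by (auto simp: tscale_def fun_eq_iff)

lemma sum_tensor_apply: "(\<Sum>i\<in>I. F i) (S :: 'a) = (\<Sum>i\<in>I. (F i S :: 'r::comm_ring_1))"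
  by (induction I rule: infinite_finite_induct) auto

lemma tscale_sum: "tscale c (\<Sum>i\<in>I. F i) = (\<Sum>i\<in>I. tscale c (F i))"
  by (auto simp: tscale_apply fun_eq_iff sum_tensor_apply sum_distrib_left)

lemma linear_ext_zero [simp]: "linear_ext \<Gamma> F 0 = 0"
  by (simp add: linear_ext_def)

lemma linear_ext_tscale: "linear_ext \<Gamma> F (tscale c t) = tscale c (linear_ext \<Gamma> F t)"
  by (auto simp: tscale_apply linear_ext_def tscale_sum fun_eq_iff sum_tensor_apply mult.assoc intro!: sum.cong)

lemma pure_cong:
  assumes "\<And>\<gamma>. \<gamma> \<in> \<Gamma> \<Longrightarrow> \<alpha> \<gamma> = \<beta> \<gamma>"
  shows "pure \<Gamma> \<alpha> = pure \<Gamma> \<beta>"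
  using assms by (auto simp: pure_def fun_eq_iff intro!: prod.cong)

text \<open>
  The values of \<open>linear_ext\<close> are prescribed on the basis \<open>1, X\<close> only. A map on labellings that is
  linear in the label of each circle of a set \<open>T\<close> agrees with its linear extension on
  enhanced states with arbitrary labels on \<open>T\<close>; the lemmas below make this precise.
\<close>

definition slot_linear :: "('r::comm_ring_1 labelling \<Rightarrow> 'r tensor) \<Rightarrow> circle \<Rightarrow> bool" where
  "slot_linear F \<gamma> \<longleftrightarrow> (\<forall>\<alpha> a b c d.
     F (\<alpha>(\<gamma> := smult c a + smult d b)) = tscale c (F (\<alpha>(\<gamma> := a))) + tscale d (F (\<alpha>(\<gamma> := b))))"

lemma pure_slot_linear:
  assumes "finite \<Gamma>" "\<gamma> \<in> \<Gamma>"
  shows "slot_linear (pure \<Gamma> :: 'r::comm_ring_1 labelling \<Rightarrow> 'r tensor) \<gamma>"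
proof -
  have "pure \<Gamma> (\<alpha>(\<gamma> := z)) S =
      (if S \<subseteq> \<Gamma> then coeff z (if \<gamma> \<in> S then 1 else 0) *
         (\<Prod>\<delta>\<in>\<Gamma> - {\<gamma>}. coeff (\<alpha> \<delta>) (if \<delta> \<in> S then 1 else 0)) else 0)" for \<alpha> :: "'r labelling" and z S
    unfolding pure_def
    by (subst prod.remove[OF assms]) (auto intro!: prod.cong arg_cong2[of _ _ _ _ "(*)"])
  then show ?thesis
    by (auto simp: slot_linear_def tscale_apply fun_eq_iff algebra_simps)
qed

lemmas pure_linear = pure_slot_linear[unfolded slot_linear_def, rule_format]

text \<open>
  Expanding only the labels on the complement of \<open>T\<close> in the basis. Keeping \<open>T\<close> small helps
  with merging saddles, where linearity in the labels of the two merged circles is enough.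
\<close>

lemma linear_ext_pure_expand:
  assumes fin: "finite \<Gamma>" and "T \<subseteq> \<Gamma>"
    and "\<And>\<gamma>. \<gamma> \<in> T \<Longrightarrow> slot_linear F \<gamma>" and "\<And>\<gamma>. \<gamma> \<in> T \<Longrightarrow> degree (\<alpha> \<gamma>) < 2"
  shows "linear_ext \<Gamma> F (pure \<Gamma> \<alpha>) =
    (\<Sum>S\<in>Pow (\<Gamma> - T). tscale (\<Prod>\<gamma>\<in>\<Gamma> - T. coeff (\<alpha> \<gamma>) (if \<gamma> \<in> S then 1 else 0))
       (F (\<lambda>\<gamma>. if \<gamma> \<in> T then \<alpha> \<gamma> else if \<gamma> \<in> S then [:0, 1:] else 1)))"
proof -
  have "finite T"
    using assms by (metis finite_subset)
  then show ?thesis using assms(2-)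
  proof (induction T)
    case empty
    show ?case
      by (auto simp: linear_ext_def pure_def intro!: sum.cong)
  next
    case (insert g T)
    define D where "D = \<Gamma> - insert g T"
    define k where "k S = (\<Prod>\<gamma>\<in>D. coeff (\<alpha> \<gamma>) (if \<gamma> \<in> S then 1 else 0))" for S
    define \<beta> where "\<beta> S = (\<lambda>\<gamma>. if \<gamma> \<in> T then \<alpha> \<gamma> else if \<gamma> \<in> S then [:0, 1:] else 1)" for S
    have \<Gamma>T: "\<Gamma> - T = insert g D" and g: "g \<notin> D" "g \<notin> T" and D: "finite D"
      using insert fin by (auto simp: D_def)
    have lab: "\<alpha> g = smult (coeff (\<alpha> g) 0) 1 + smult (coeff (\<alpha> g) 1) [:0, 1:]"
    proof -
      have "degree (\<alpha> g) < 2"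
        using insert by auto
      then show ?thesis
        by (intro poly_eqI) (auto simp: coeff_pCons coeff_eq_0 one_pCons split: nat.split)
    qed
    \<comment> \<open>Linearity at \<open>g\<close> trades the two basis labels of \<open>g\<close> for its actual label.\<close>
    have slot: "F (\<beta>' (g := \<alpha> g)) = tscale (coeff (\<alpha> g) 0) (F (\<beta>'(g := 1)))
        + tscale (coeff (\<alpha> g) 1) (F (\<beta>'(g := [:0, 1:])))" for \<beta>'
      using insert.prems(2)[of g] lab unfolding slot_linear_def by (metis insertI1)
    have prod0: "(\<Prod>\<gamma>\<in>insert g D. coeff (\<alpha> \<gamma>) (if \<gamma> \<in> S then 1 else 0)) = coeff (\<alpha> g) 0 * k S"
      if "S \<subseteq> D" for S
      using that g D by (auto simp: k_def)
    have prod1: "(\<Prod>\<gamma>\<in>insert g D. coeff (\<alpha> \<gamma>) (if \<gamma> \<in> insert g S then 1 else 0)) =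
        coeff (\<alpha> g) 1 * k S" for S
    proof -
      have "(\<Prod>\<gamma>\<in>D. coeff (\<alpha> \<gamma>) (if \<gamma> \<in> insert g S then 1 else 0)) = k S"
        unfolding k_def using g by (intro prod.cong) auto
      then show ?thesis
        using g D by (simp del: insert_iff) (simp add: mult.commute)
    qed
    have "linear_ext \<Gamma> F (pure \<Gamma> \<alpha>) =
        (\<Sum>S\<in>Pow (insert g D). tscale (\<Prod>\<gamma>\<in>insert g D. coeff (\<alpha> \<gamma>) (if \<gamma> \<in> S then 1 else 0)) (F (\<beta> S)))"
      using insert by (simp add: \<beta>_def \<Gamma>T)
    also have "\<dots> = (\<Sum>S\<in>Pow D. tscale (coeff (\<alpha> g) 0 * k S) (F (\<beta> S))) +
        (\<Sum>S\<in>Pow D. tscale (coeff (\<alpha> g) 1 * k S) (F (\<beta> (insert g S))))"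
    proof -
      have inj: "inj_on (insert g) (Pow D)"
        using g by (auto simp: inj_on_def)
      have "Pow D \<inter> insert g ` Pow D = {}"
        using g by auto
      then show ?thesis
        using D prod0 by (simp add: Pow_insert sum.union_disjoint sum.reindex[OF inj] prod1 del: insert_iff)
    qed
    also have "\<dots> = (\<Sum>S\<in>Pow D. tscale (k S) (F ((\<beta> S)(g := \<alpha> g))))"
    proof -
      have "(\<beta> S)(g := 1) = \<beta> S" "(\<beta> S)(g := [:0, 1:]) = \<beta> (insert g S)" if "S \<subseteq> D" for S
        using that g by (auto simp: \<beta>_def fun_eq_iff)
      then show ?thesis
        unfolding sum.distrib[symmetric]
        by (intro sum.cong refl) (simp add: slot, simp add: fun_eq_iff tscale_apply algebra_simps)
    qed
    also have "\<dots> = (\<Sum>S\<in>Pow D. tscale (k S)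
        (F (\<lambda>\<gamma>. if \<gamma> \<in> insert g T then \<alpha> \<gamma> else if \<gamma> \<in> S then [:0, 1:] else 1)))"
      by (intro sum.cong refl arg_cong2[of _ _ _ _ tscale] arg_cong[of _ _ F]) (auto simp: \<beta>_def fun_eq_iff)
    finally show ?case
      by (simp add: k_def D_def)
  qed
qed

lemma linear_ext_pure:
  assumes "finite \<Gamma>" "\<And>\<gamma>. \<gamma> \<in> \<Gamma> \<Longrightarrow> slot_linear F \<gamma>" "\<And>\<gamma>. \<gamma> \<in> \<Gamma> \<Longrightarrow> degree (\<alpha> \<gamma>) < 2"
  shows "linear_ext \<Gamma> F (pure \<Gamma> \<alpha>) = F (\<lambda>\<gamma>. if \<gamma> \<in> \<Gamma> then \<alpha> \<gamma> else 1)"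
  using linear_ext_pure_expand[of \<Gamma> \<Gamma> F \<alpha>, OF assms(1) order_refl assms(2,3)]
  by (simp cong: if_cong)

section \<open>The Frobenius algebra\<close>

text \<open>
  Since \<open>R\<close> may have zero divisors here, uniqueness of the remainder uses that the divisor is monic: a nonzero multiple
  has degree at least 2.
\<close>

lemma monic_quadratic_remainder_unique:
  assumes "x_white x1 * x_black x2 dvd g" "degree g < 2"
  shows "g = 0"
proof (rule ccontr)
  assume "g \<noteq> 0"
  obtain q where q: "g = (x_white x1 * x_black x2) * q"
    using assms by blast
  have P: "x_white x1 * x_black x2 = [:x1 * x2, - x1 - x2, 1:]"
    by (simp add: x_white_def x_black_def)
  have "q \<noteq> 0"
    using \<open>g \<noteq> 0\<close> q by auto
  have "coeff g (2 + degree q) = lead_coeff q"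
    using coeff_mult_degree_sum[of "[:x1 * x2, - x1 - x2, 1:]" q] unfolding q P by (simp add: numeral_2_eq_2)
  then have "2 + degree q \<le> degree g"
    using \<open>q \<noteq> 0\<close> by (intro le_degree) simp
  then show False
    using assms by simp
qed

lemma reduce_eqI:
  assumes "degree g < 2" "x_white x1 * x_black x2 dvd f - g"
  shows "reduce x1 x2 f = g"
  unfolding reduce_def
proof (rule the_equality)
  fix h assume h: "degree h < 2 \<and> x_white x1 * x_black x2 dvd f - h"
  have "x_white x1 * x_black x2 dvd (f - g) - (f - h)"
    using h assms dvd_diff by blast
  moreover have "degree (h - g) < 2"
    using h assms by (intro degree_diff_less) auto
  ultimately show "h = g"
    using monic_quadratic_remainder_unique[of x1 x2 "h - g"] by (simp add: algebra_simps)
qed (use assms in auto)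

text \<open>
  Existence of the remainder, by Horner's scheme: reducing \<open>a + X f\<close> only needs the remainder of
  \<open>f\<close> and one application of \<open>X\<^sup>2 = (x\<^sub>1 + x\<^sub>2) X - x\<^sub>1 x\<^sub>2\<close>.
\<close>

lemma reduce_is_remainder:
  "degree (reduce x1 x2 f) < 2 \<and> x_white x1 * x_black x2 dvd f - reduce x1 x2 f"
proof -
  have "\<exists>g. degree g < 2 \<and> x_white x1 * x_black x2 dvd f - g"
  proof (induction f)
    case 0
    show ?case by (intro exI[of _ 0]) auto
  next
    case (pCons a f)
    then obtain g q where g: "degree g < 2" "f - g = x_white x1 * x_black x2 * q"
      by auto
    obtain b c where bc: "g = [:b, c:]"
    proof
      show "g = [:coeff g 0, coeff g 1:]"
        using g(1) by (intro poly_eqI) (auto simp: coeff_pCons coeff_eq_0 split: nat.split)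
    qed
    define P where "P = x_white x1 * x_black x2"
    define h where "h = [:a - c * (x1 * x2), b + c * (x1 + x2):]"
    define X where "X = [:0, 1 :: 'a:]"
    have f: "f = P * q + g"
      using g(2) by (simp add: P_def algebra_simps)
    have rem: "[:a:] + X * g - h = P * [:c:]"
      by (simp add: bc x_white_def x_black_def P_def h_def X_def algebra_simps)
    have "pCons a f - h = [:a:] + X * f - h"
      by (simp add: X_def)
    also have "\<dots> = P * (X * q) + ([:a:] + X * g - h)"
      by (simp add: f algebra_simps)
    finally have "pCons a f - h = P * (X * q + [:c:])"
      by (simp add: rem distrib_left)
    then show ?case
      by (intro exI[of _ h]) (auto simp: degree_pCons_eq_if h_def P_def)
  qed
  then obtain g where "degree g < 2" "x_white x1 * x_black x2 dvd f - g"
    by auto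
  then show ?thesis
    using reduce_eqI[of g x1 x2 f] by simp
qed

lemma reduce_linear:
  "reduce x1 x2 (smult c f + smult d g) = smult c (reduce x1 x2 f) + smult d (reduce x1 x2 g)"
proof (rule reduce_eqI)
  let ?P = "x_white x1 * x_black x2"
  show "degree (smult c (reduce x1 x2 f) + smult d (reduce x1 x2 g)) < 2"
    using reduce_is_remainder[of x1 x2] by (intro degree_add_less le_less_trans[OF degree_smult_le]) auto
  have "?P dvd smult c (f - reduce x1 x2 f) + smult d (g - reduce x1 x2 g)"
    using reduce_is_remainder[of x1 x2] by (intro dvd_add dvd_smult) auto
  then show "?P dvd smult c f + smult d g - (smult c (reduce x1 x2 f) + smult d (reduce x1 x2 g))"
    by (simp add: algebra_simps smult_diff_right)
qed

lemma mult_commute: "mult x1 x2 a b = mult x1 x2 b a"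
  by (simp add: mult_def mult.commute)

lemma mult_linear:
  "mult x1 x2 (smult c a + smult d b) e = smult c (mult x1 x2 a e) + smult d (mult x1 x2 b e)"
  by (simp only: mult_def distrib_right mult_smult_left reduce_linear)

definition opposite :: "'r::comm_ring_1 \<Rightarrow> 'r \<Rightarrow> 'r poly \<Rightarrow> 'r poly \<Rightarrow> bool" where
  "opposite x1 x2 a b \<longleftrightarrow>
     a = x_white x1 \<and> b = x_black x2 \<or> a = x_black x2 \<and> b = x_white x1"

lemma opposite_mult: "opposite x1 x2 a b \<Longrightarrow> mult x1 x2 a b = 0"
  unfolding mult_def by (intro reduce_eqI) (auto simp: opposite_def mult.commute)

text \<open>
  The relation \<open>(X - y) (X - z) = 0\<close> says that \<open>X\<close> acts on \<open>X - y\<close> as the scalar \<open>z\<close>.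
\<close>

lemma opposite_mult_X:
  assumes "opposite x1 x2 [:- y, 1:] [:- z, 1:]"
  shows "mult x1 x2 [:- y, 1:] [:0, 1:] = smult z [:- y, 1:]"
  unfolding mult_def
proof (rule reduce_eqI)
  have "[:- y, 1:] * [:0, 1:] - smult z [:- y, 1:] = [:- y, 1:] * [:- z, 1:]"
    by (simp add: algebra_simps)
  also have "\<dots> = x_white x1 * x_black x2"
    using assms unfolding opposite_def by (metis mult.commute)
  finally show "x_white x1 * x_black x2 dvd [:- y, 1:] * [:0, 1:] - smult z [:- y, 1:]"
    by simp
qed (simp add: degree_smult_le)

text \<open>
  The sign in the last alternative is the source of the sign in the formula for negative stabilizations.
\<close>

lemma opposite_cases:
  assumes "opposite x1 x2 a b"
  obtains y z where "a = [:- y, 1:]" "b = [:- z, 1:]" "x1 + x2 = y + z"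
    "x1 - x2 = y - z \<or> x1 - x2 = - (y - z)"
  using assms that[of x1 x2] that[of x2 x1]
  by (auto simp: opposite_def x_white_def x_black_def algebra_simps)

text \<open>
  The state obtained from \<open>\<alpha>\<close> by putting \<open>\<Delta>(a)\<close> on the circles \<open>g\<close> and \<open>h\<close>.
\<close>

definition comult_at :: "'r::comm_ring_1 \<Rightarrow> 'r \<Rightarrow> circle set \<Rightarrow> circle \<Rightarrow> circle \<Rightarrow> 'r poly \<Rightarrow> 'r labelling \<Rightarrow> 'r tensor" where
  "comult_at x1 x2 \<Gamma> g h a \<alpha> = (\<Sum>(p, q)\<leftarrow>comult x1 x2 a. pure \<Gamma> (\<alpha>(g := p, h := q)))"

lemma comult_at_linear:
  assumes "finite \<Gamma>" "g \<in> \<Gamma>" "h \<in> \<Gamma>" "g \<noteq> h"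
  shows "comult_at x1 x2 \<Gamma> g h (smult c a + smult d b) \<alpha> =
    tscale c (comult_at x1 x2 \<Gamma> g h a \<alpha>) + tscale d (comult_at x1 x2 \<Gamma> g h b \<alpha>)"
proof -
  have lin: "pure \<Gamma> (\<alpha>(g := smult c a + smult d b, h := q)) =
      tscale c (pure \<Gamma> (\<alpha>(g := a, h := q))) + tscale d (pure \<Gamma> (\<alpha>(g := b, h := q)))" for a b q
    using pure_linear[OF assms(1,2), of "\<alpha>(h := q)"] assms(4) by (simp add: fun_upd_twist)
  have "smult e (smult c a + smult d b) = smult c (smult e a) + smult d (smult e b)" for e
    by (simp add: smult_add_right mult.commute)
  then show ?thesis
    unfolding comult_at_def comult_def
    by (simp add: mult_linear lin del: smult_smult) (simp add: fun_eq_iff tscale_apply algebra_simps)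
qed

text \<open>
  The identity \<open>\<Delta>(a) = a \<otimes> a\<close>: for \<open>a = X - y\<close> with \<open>a X = z a\<close>,
  \<open>\<Delta>(a) = z (a \<otimes> 1) + a \<otimes> X - (y + z) (a \<otimes> 1) = a \<otimes> (X - y)\<close>.
\<close>

lemma comult_at_opposite:
  assumes "finite \<Gamma>" "g \<in> \<Gamma>" "h \<in> \<Gamma>" "g \<noteq> h" and ab: "opposite x1 x2 a b"
  shows "comult_at x1 x2 \<Gamma> g h a \<alpha> = pure \<Gamma> (\<alpha>(g := a, h := a))"
proof -
  obtain y z where a: "a = [:- y, 1:]" and b: "b = [:- z, 1:]" and yz: "x1 + x2 = y + z"
    using opposite_cases[OF ab] by metis
  then have x1: "x1 = y + z - x2"
    by (simp add: algebra_simps)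
  have lin: "pure \<Gamma> (\<alpha>(g := smult c a, h := q)) = tscale c (pure \<Gamma> (\<alpha>(g := a, h := q)))" for c q
    using pure_linear[OF assms(1,2), of "\<alpha>(h := q)" c a 0 a] assms(4) by (simp add: fun_upd_twist)
  have split: "a = smult 1 [:0, 1:] + smult (- y) 1"
    by (simp add: a one_pCons)
  have "pure \<Gamma> (\<alpha>(g := a, h := a)) =
      tscale 1 (pure \<Gamma> (\<alpha>(g := a, h := [:0, 1:]))) + tscale (- y) (pure \<Gamma> (\<alpha>(g := a, h := 1)))"
    using pure_linear[OF assms(1,3), of "\<alpha>(g := a)" 1 "[:0, 1:]" "- y" 1] split by simp
  moreover have "mult x1 x2 a [:0, 1:] = smult z a"
    using opposite_mult_X[of x1 x2 y z] ab a b by simp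
  ultimately show ?thesis
    unfolding comult_at_def comult_def by (simp add: lin) (simp add: x1 fun_eq_iff tscale_apply algebra_simps)
qed

section \<open>Circles of a stack of layers\<close>

abbreviation conn :: "layer list \<Rightarrow> (point \<times> point) set" where
  "conn fs \<equiv> (arcs fs \<union> (arcs fs)\<inverse>)\<^sup>*"

lemma conn_sym: "(p, q) \<in> conn fs \<Longrightarrow> (q, p) \<in> conn fs"
  by (meson sym_Un_converse sym_rtrancl symD)

lemma circ_refl: "p \<in> points n fs \<Longrightarrow> p \<in> circ n fs p"
  by (simp add: circ_def)

lemma circ_eq: "q \<in> circ n fs p \<Longrightarrow> circ n fs q = circ n fs p"
proof -
  assume "q \<in> circ n fs p"
  then have "(p, q) \<in> conn fs" "(q, p) \<in> conn fs"
    by (simp_all add: circ_def conn_sym)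
  then have "(q, r) \<in> conn fs \<longleftrightarrow> (p, r) \<in> conn fs" for r
    by (meson rtrancl_trans)
  then show ?thesis
    by (simp add: circ_def)
qed

lemma circ_in_circles: "p \<in> points n fs \<Longrightarrow> circ n fs p \<in> circles n fs"
  by (simp add: circles_def)

lemma circles_memb: "\<gamma> \<in> circles n fs \<Longrightarrow> p \<in> \<gamma> \<Longrightarrow> \<gamma> = circ n fs p"
  unfolding circles_def using circ_eq by blast

lemma finite_circles: "finite (circles n fs)"
  by (simp add: circles_def points_def)

text \<open>
  A circle is determined by exhibiting a function \<open>\<kappa>\<close> that is constant along the arcs and whose
  level sets are connected.
\<close>

lemma circ_by_invariant:
  assumes "p \<in> points n fs"
    and "\<And>a b. (a, b) \<in> arcs fs \<Longrightarrow> \<kappa> a = \<kappa> b"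
    and "\<And>q. q \<in> points n fs \<Longrightarrow> \<kappa> q = \<kappa> p \<Longrightarrow> (p, q) \<in> conn fs"
  shows "circ n fs p = {q \<in> points n fs. \<kappa> q = \<kappa> p}"
proof -
  have "\<kappa> q = \<kappa> p" if "(p, q) \<in> conn fs" for q
    using that by (induction rule: rtrancl_induct) (use assms(2) in auto)
  then have "q \<in> points n fs \<and> (p, q) \<in> conn fs \<longleftrightarrow> q \<in> points n fs \<and> \<kappa> q = \<kappa> p" for q
    using assms(3) by metis
  then show ?thesis
    unfolding circ_def by (rule Collect_cong)
qed

lemma conn_layer: "k < length fs \<Longrightarrow> (p, q) \<in> layer_arcs k (fs ! k) \<Longrightarrow> (p, q) \<in> conn fs"
proof -
  assume "k < length fs" "(p, q) \<in> layer_arcs k (fs ! k)"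
  then have "(p, q) \<in> arcs fs"
    unfolding arcs_def by blast
  then show ?thesis
    by blast
qed

lemma conn_closing: "((0, j), (length fs, j)) \<in> conn fs"
proof -
  have "((0, j), (length fs, j)) \<in> arcs fs"
    unfolding arcs_def by blast
  then show ?thesis
    by blast
qed

lemma conn_vertical:
  assumes "\<And>l. l < k \<Longrightarrow> fs ! l = Vert" "k \<le> length fs"
  shows "((0, j), (k, j)) \<in> conn fs"
  using assms
proof (induction k)
  case (Suc k)
  have "((k, j), (Suc k, j)) \<in> conn fs"
    using Suc.prems by (intro conn_layer[of k]) auto
  with Suc show ?case
    by (meson Suc_leD less_Suc_eq rtrancl_trans)
qed simp

text \<open>
  \<open>column N j\<close> is the strand \<open>j\<close> of a stack of height \<open>N\<close>. Besides the stacks \<open>vert N\<close> without caps, which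
  are the oriented resolutions, only the stacks \<open>capped n N\<close> matter, where the strands \<open>n\<close> and \<open>n + 1\<close>
  are fused by a cup and a cap on top; these occur in a negative stabilization.
\<close>

definition column :: "nat \<Rightarrow> nat \<Rightarrow> circle" where
  "column N j = {0..N} \<times> {j}"

abbreviation vert :: "nat \<Rightarrow> layer list" where
  "vert N \<equiv> replicate N Vert"

abbreviation capped :: "nat \<Rightarrow> nat \<Rightarrow> layer list" where
  "capped n N \<equiv> vert N @ [Cupcap n]"

lemma column_inj [simp]: "column N i = column N j \<longleftrightarrow> i = j"
  by (auto simp: column_def set_eq_iff)

lemma circ_vert:
  assumes "1 \<le> j" "j \<le> n" "k \<le> N"
  shows "circ n (vert N) (k, j) = column N j"
proof -
  have "circ n (vert N) (k, j) = {q \<in> points n (vert N). snd q = snd (k, j)}"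
  proof (rule circ_by_invariant)
    fix q assume q: "q \<in> points n (vert N)" "snd q = snd (k, j)"
    then obtain k' where k': "q = (k', j)" "k' \<le> N"
      by (auto simp: points_def)
    have "((0, j), (k, j)) \<in> conn (vert N)" "((0, j), (k', j)) \<in> conn (vert N)"
      using assms k' by (auto intro!: conn_vertical)
    then show "((k, j), q) \<in> conn (vert N)"
      using k' by (meson conn_sym rtrancl_trans)
  next
    show "(k, j) \<in> points n (vert N)"
      using assms by (simp add: points_def)
    show "snd a = snd b" if "(a, b) \<in> arcs (vert N)" for a b
      using that by (auto simp: arcs_def)
  qed
  also have "\<dots> = column N j"
    using assms by (auto simp: points_def column_def)
  finally show ?thesis .
qed

lemma circles_vert: "circles n (vert N) = column N ` {1..n}"
proof -
  have "circles n (vert N) = (\<lambda>(k, j). circ n (vert N) (k, j)) ` ({0..N} \<times> {1..n})"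
    by (simp add: circles_def points_def)
  also have "\<dots> = (\<lambda>(k, j). column N j) ` ({0..N} \<times> {1..n})"
    by (rule image_cong) (auto simp: circ_vert)
  also have "\<dots> = column N ` {1..n}"
    by force
  finally show ?thesis .
qed

text \<open>
  The invariant is \<open>min n j\<close>, which identifies the strands \<open>n\<close> and \<open>n + 1\<close> and no others.
\<close>

lemma circ_capped:
  assumes "1 \<le> n" "1 \<le> j" "j \<le> Suc n" "k \<le> Suc N"
  shows "circ (Suc n) (capped n N) (k, j) =
    (if j < n then column (Suc N) j else column (Suc N) n \<union> column (Suc N) (Suc n))"
proof -
  let ?fs = "capped n N"
  have len: "length ?fs = Suc N"
    by simp
  have low: "?fs ! l = Vert" if "l < N" for l
    using that by (simp add: nth_append)
  \<comment> \<open>The topmost height lies above the cup and cap and is reached along the closing strands only.\<close>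
  have base: "((0, i), (l, i)) \<in> conn ?fs" if "l \<le> Suc N" for l i
  proof (cases "l = Suc N")
    case True
    show ?thesis
      using conn_closing[of i ?fs] unfolding len True .
  next
    case False
    then have "l \<le> N"
      using that by simp
    then show ?thesis
      using low by (intro conn_vertical) (simp_all add: len)
  qed
  have "((N, n), (N, Suc n)) \<in> layer_arcs N (?fs ! N)"
    by (simp add: nth_append)
  then have "((N, n), (N, Suc n)) \<in> conn ?fs"
    by (intro conn_layer[of N]) (simp_all only: len lessI)
  then have cap: "((0, n), (0, Suc n)) \<in> conn ?fs"
    using base[of N n] base[of N "Suc n"] conn_sym rtrancl_trans by (meson le_SucI order_refl)
  have bottom: "((0, i), (0, i')) \<in> conn ?fs" if "min n i = min n i'" "i \<le> Suc n" "i' \<le> Suc n" for i i'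
  proof (cases "i = i'")
    case False
    then have "i = n \<and> i' = Suc n \<or> i = Suc n \<and> i' = n"
      using that by (auto simp: min_def split: if_splits)
    then show ?thesis
      using cap conn_sym by blast
  qed simp
  have "circ (Suc n) ?fs (k, j) = {q \<in> points (Suc n) ?fs. min n (snd q) = min n (snd (k, j))}"
  proof (rule circ_by_invariant)
    fix q assume q: "q \<in> points (Suc n) ?fs" "min n (snd q) = min n (snd (k, j))"
    then obtain k' j' where k': "q = (k', j')" "k' \<le> Suc N" "j' \<le> Suc n" "min n j = min n j'"
      by (auto simp: points_def)
    then show "((k, j), q) \<in> conn ?fs"
      using base[of k j] base[of k' j'] bottom[of j j'] assms by (meson conn_sym rtrancl_trans)
  next
    fix a b assume "(a, b) \<in> arcs ?fs"
    then show "min n (snd a) = min n (snd b)"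
      by (auto simp: arcs_def nth_append split: if_splits)
  next
    show "(k, j) \<in> points (Suc n) ?fs"
      using assms by (simp add: points_def)
  qed
  also have "\<dots> = (if j < n then column (Suc N) j else column (Suc N) n \<union> column (Suc N) (Suc n))"
    using assms by (auto simp: points_def column_def min_def split: if_splits)
  finally show ?thesis .
qed

lemma circles_capped:
  assumes "1 \<le> n"
  shows "circles (Suc n) (capped n N) =
    insert (column (Suc N) n \<union> column (Suc N) (Suc n)) (column (Suc N) ` {1..<n})"
proof
  show "circles (Suc n) (capped n N) \<subseteq>
      insert (column (Suc N) n \<union> column (Suc N) (Suc n)) (column (Suc N) ` {1..<n})"
  proof
    fix \<gamma> assume "\<gamma> \<in> circles (Suc n) (capped n N)"
    then obtain k j where "\<gamma> = circ (Suc n) (capped n N) (k, j)" and kj: "k \<le> Suc N" "1 \<le> j" "j \<le> Suc n"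
      by (auto simp: circles_def points_def)
    then have "\<gamma> = (if j < n then column (Suc N) j else column (Suc N) n \<union> column (Suc N) (Suc n))"
      using assms by (simp only: circ_capped)
    then show "\<gamma> \<in> insert (column (Suc N) n \<union> column (Suc N) (Suc n)) (column (Suc N) ` {1..<n})"
      using kj by simp
  qed
  have "column (Suc N) j \<in> circles (Suc n) (capped n N)" if "j \<in> {1..<n}" for j
    using that circ_capped[of n j 0 N] circ_in_circles[of "(0, j)" "Suc n" "capped n N"]
    by (auto simp: points_def)
  moreover have "column (Suc N) n \<union> column (Suc N) (Suc n) \<in> circles (Suc n) (capped n N)"
    using assms circ_capped[of n n 0 N] circ_in_circles[of "(0, n)" "Suc n" "capped n N"]
    by (auto simp: points_def)
  ultimately show "insert (column (Suc N) n \<union> column (Suc N) (Suc n)) (column (Suc N) ` {1..<n}) \<subseteq>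
      circles (Suc n) (capped n N)"
    by blast
qed

text \<open>
  The outermost strand of a circle; taking the least one gives the circle fusing the strands \<open>n\<close> and
  \<open>n + 1\<close> the label of the strand \<open>n\<close>.
\<close>

definition strand :: "circle \<Rightarrow> nat" where
  "strand \<gamma> = (LEAST j. j \<in> snd ` \<gamma>)"

lemma strand_column [simp]: "strand (column N j) = j"
  unfolding strand_def column_def by (rule Least_equality) auto

lemma strand_union [simp]: "strand (column N j \<union> column N (Suc j)) = j"
  unfolding strand_def column_def by (rule Least_equality) (auto simp: image_Un)

lemma winding_column:
  assumes "1 \<le> j" "j \<le> n"
  shows "winding n (vert N) (column N j) = (j - 1) mod 2"
proof -
  define p where "p = (SOME p. p \<in> column N j)"
  have "p \<in> column N j"
    unfolding p_def by (rule someI[of _ "(0, j)"]) (auto simp: column_def)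
  then obtain k where k: "p = (k, j)" "k \<le> N"
    by (auto simp: column_def)
  have "{j'. (k, j') \<in> \<Union>(circles n (vert N)) \<and> j' < j} = {1..<j}"
    using k assms by (auto simp: circles_vert column_def)
  then show ?thesis
    unfolding winding_def p_def[symmetric] k(1) by simp
qed

section \<open>Saddles merging opposite labels\<close>

text \<open>
  A merge of two circles whose labels multiply to \<open>0\<close> vanishes. The other circles can be
  arbitrary: all that has to be known about the new stack is that no circle of it other than the
  merged one coincides with one of the two old circles.
\<close>

lemma saddle_merge_zero:
  assumes "k < length fs" "fs ! k = Vert" "1 \<le> i" "Suc i \<le> n"
    and ne: "circ n fs (k, i) \<noteq> circ n fs (Suc k, Suc i)"
    and deg: "degree (\<alpha> (circ n fs (k, i))) < 2" "degree (\<alpha> (circ n fs (Suc k, Suc i))) < 2"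
    and zero: "mult x1 x2 (\<alpha> (circ n fs (k, i))) (\<alpha> (circ n fs (Suc k, Suc i))) = 0"
  shows "saddle x1 x2 n fs (fs[k := Cupcap i]) k i (pure (circles n fs) \<alpha>) = 0"
proof -
  define fs' where "fs' = fs[k := Cupcap i]"
  define g h g' where "g = circ n fs (k, i)" and "h = circ n fs (Suc k, Suc i)" and "g' = circ n fs' (k, i)"
  define \<Gamma> \<Gamma>' where "\<Gamma> = circles n fs" and "\<Gamma>' = circles n fs'"
  define F where "F = (\<lambda>\<alpha>. pure \<Gamma>' (\<alpha>(g' := mult x1 x2 (\<alpha> g) (\<alpha> h))))"
  have pts: "(k, i) \<in> points n fs" "(Suc k, Suc i) \<in> points n fs" "(k, i) \<in> points n fs'"
      "(k, Suc i) \<in> points n fs" "(k, Suc i) \<in> points n fs'"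
    using assms by (auto simp: points_def fs'_def)
  have gh: "g \<noteq> h" "g \<in> \<Gamma>" "h \<in> \<Gamma>" "g' \<in> \<Gamma>'" "finite \<Gamma>" "finite \<Gamma>'"
    using ne pts by (auto simp: g_def h_def g'_def \<Gamma>_def \<Gamma>'_def circ_in_circles finite_circles)
  have "((k, i), (k, Suc i)) \<in> conn fs'"
    using assms by (intro conn_layer[of k]) (auto simp: fs'_def)
  then have cap: "circ n fs' (k, Suc i) = g'"
    unfolding g'_def by (intro circ_eq) (use pts in \<open>auto simp: circ_def\<close>)
  have "((k, Suc i), (Suc k, Suc i)) \<in> conn fs"
    using assms by (intro conn_layer[of k]) auto
  then have kh: "(k, Suc i) \<in> h"
    using pts conn_sym by (auto simp: circ_def h_def)
  \<comment> \<open>Both \<open>g\<close> and \<open>h\<close> contain an end of the new lower arc, which lies on the merged circle.\<close>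
  have only: "\<delta> = g'" if "\<delta> \<in> \<Gamma>'" "\<delta> = g \<or> \<delta> = h" for \<delta>
    using that(2)
  proof
    assume "\<delta> = g"
    then have "(k, i) \<in> \<delta>"
      using pts by (simp add: g_def circ_refl)
    then show ?thesis
      using that(1) circles_memb g'_def \<Gamma>'_def by metis
  next
    assume "\<delta> = h"
    then show ?thesis
      using kh that(1) circles_memb cap \<Gamma>'_def by metis
  qed
  have slot_g: "slot_linear F g"
  proof -
    have "F (\<beta>(g := z)) = pure \<Gamma>' (\<beta>(g' := mult x1 x2 z (\<beta> h)))" for \<beta> z
      unfolding F_def using gh(1) by (intro pure_cong) (simp add: fun_upd_def, metis only)
    then show ?thesis
      by (simp add: slot_linear_def mult_linear pure_linear gh)
  qed
  have slot_h: "slot_linear F h"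
  proof -
    have "F (\<beta>(h := z)) = pure \<Gamma>' (\<beta>(g' := mult x1 x2 z (\<beta> g)))" for \<beta> z
      unfolding F_def using gh(1) by (intro pure_cong) (simp add: fun_upd_def, metis only mult_commute)
    then show ?thesis
      by (simp add: slot_linear_def mult_linear pure_linear gh)
  qed
  have vanish: "F \<beta> = 0" if "mult x1 x2 (\<beta> g) (\<beta> h) = 0" for \<beta>
    using pure_linear[OF gh(6,4), of \<beta> 0 0 0 0] that by (simp add: F_def)
  have "saddle x1 x2 n fs fs' k i (pure \<Gamma> \<alpha>) = linear_ext \<Gamma> F (pure \<Gamma> \<alpha>)"
    unfolding saddle_def Let_def F_def using gh(1)
    by (simp flip: g_def h_def g'_def \<Gamma>_def \<Gamma>'_def)
  also have "\<dots> = (\<Sum>S\<in>Pow (\<Gamma> - {g, h}).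
      tscale (\<Prod>\<gamma>\<in>\<Gamma> - {g, h}. coeff (\<alpha> \<gamma>) (if \<gamma> \<in> S then 1 else 0))
       (F (\<lambda>\<gamma>. if \<gamma> \<in> {g, h} then \<alpha> \<gamma> else if \<gamma> \<in> S then [:0, 1:] else 1)))"
    using gh slot_g slot_h deg by (intro linear_ext_pure_expand) (auto simp: g_def h_def)
  also have "\<dots> = 0"
    using zero by (intro sum.neutral ballI) (simp add: vanish g_def h_def)
  finally show ?thesis
    by (simp add: fs'_def \<Gamma>_def)
qed

section \<open>Cycles labelled by strands\<close>

lemma resolve_oriented [simp]: "resolve c (is_Neg c) = Vert"
  by (cases c) auto

lemma length_oriented [simp]: "length (oriented w) = length w"
  by (simp add: oriented_def)

lemma length_layers [simp]: "length r = length w \<Longrightarrow> length (layers w r) = length w"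
  by (simp add: layers_def)

lemma layers_oriented [simp]: "layers w (oriented w) = vert (length w)"
  by (induction w) (auto simp: layers_def oriented_def)

lemma layers_append: "length r = length u \<Longrightarrow> layers (u @ v) (r @ r') = layers u r @ layers v r'"
  by (simp add: layers_def)

lemma layers_update:
  "length r = length w \<Longrightarrow> k < length w \<Longrightarrow>
    layers w (r[k := b]) = (layers w r)[k := resolve (w ! k) b]"
  by (intro nth_equalityI) (auto simp: layers_def nth_list_update)

definition strand_state :: "nat \<Rightarrow> layer list \<Rightarrow> (nat \<Rightarrow> 'r::comm_ring_1 poly) \<Rightarrow> 'r tensor" where
  "strand_state n fs f = pure (circles n fs) (\<lambda>\<gamma>. f (strand \<gamma>))"

definition concentrated :: "bool list \<Rightarrow> 'r::comm_ring_1 tensor \<Rightarrow> 'r chain" where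
  "concentrated r0 t = (\<lambda>r. if r = r0 then t else 0)"

text \<open>
  For alternating \<open>f\<close> these are the beta-cycles, see \<open>beta_strands\<close>.
\<close>

definition strand_chain :: "nat \<Rightarrow> letter list \<Rightarrow> (nat \<Rightarrow> 'r::comm_ring_1 poly) \<Rightarrow> 'r chain" where
  "strand_chain n w f = concentrated (oriented w) (strand_state n (vert (length w)) f)"

lemma strand_chain_apply:
  "strand_chain n w f r = (if r = oriented w then strand_state n (vert (length w)) f else 0)"
  by (simp add: strand_chain_def concentrated_def)

lemma strand_state_support: "strand_state n fs f S \<noteq> 0 \<Longrightarrow> S \<subseteq> circles n fs"
  by (auto simp: strand_state_def pure_def split: if_splits)

lemma strand_chain_in_chains: "strand_chain n w f \<in> chains n w"
  using strand_state_support[of n "vert (length w)" f]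
  by (auto simp: chains_def strand_chain_apply split: if_splits)

lemma strand_chain_in_chains_deg: "strand_chain n w f \<in> chains_deg n w 0"
proof -
  have "length (filter id (oriented w)) = n_minus w"
    by (induction w) (auto simp: oriented_def n_minus_def)
  then show ?thesis
    using strand_chain_in_chains[of n w f] by (auto simp: chains_deg_def strand_chain_apply split: if_splits)
qed

lemma strand_state_vert_cong:
  assumes "\<And>j. 1 \<le> j \<Longrightarrow> j \<le> n \<Longrightarrow> \<alpha> (column N j) = f j"
  shows "pure (circles n (vert N)) \<alpha> = strand_state n (vert N) f"
  unfolding strand_state_def using assms by (intro pure_cong) (auto simp: circles_vert)

definition alternating :: "'r::comm_ring_1 \<Rightarrow> 'r \<Rightarrow> (nat \<Rightarrow> 'r poly) \<Rightarrow> bool" where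
  "alternating x1 x2 f \<longleftrightarrow> (\<forall>j. opposite x1 x2 (f j) (f (Suc j)))"

lemma alternating_degree: "alternating x1 x2 f \<Longrightarrow> degree (f j) < 2"
  by (auto simp: alternating_def opposite_def x_white_def x_black_def dest!: spec[of _ j])

text \<open>
  The geometric hypothesis (neighbouring strands lie on circles labelled by these very strands)
  holds both for the stacks \<open>vert N\<close> and for the relevant crossings of \<open>capped n N\<close>.
\<close>

lemma strand_state_merge_zero:
  assumes "alternating x1 x2 f" "k < length fs" "fs ! k = Vert" "1 \<le> i" "Suc i \<le> n"
    and "strand (circ n fs (k, i)) = i" "strand (circ n fs (Suc k, Suc i)) = Suc i"
  shows "saddle x1 x2 n fs (fs[k := Cupcap i]) k i (strand_state n fs f) = 0"
  unfolding strand_state_def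
proof (rule saddle_merge_zero)
  show "circ n fs (k, i) \<noteq> circ n fs (Suc k, Suc i)"
    using assms(6,7) by auto
qed (use assms in \<open>simp_all add: alternating_degree alternating_def opposite_mult\<close>)

lemma saddle_zero [simp]: "saddle x1 x2 n fs fs' k i 0 = 0"
  by (simp add: saddle_def Let_def)

lemma diff_at_zero [simp]: "diff_at x1 x2 n w s k 0 = 0"
  by (auto simp: diff_at_def Let_def fun_eq_iff tscale_apply)

lemma diff_at_concentrated:
  assumes "length r0 = length w" "k < length w" "\<not> r0 ! k"
  shows "diff_at x1 x2 n w s k (concentrated r0 t) =
    concentrated (r0[k := True]) (tscale (of_int (s r0 (r0[k := True])))
      (saddle x1 x2 n (layers w r0) (layers w (r0[k := True])) k (idx (w ! k)) t))"
proof
  fix r'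
  have "r'[k := False] = r0 \<longleftrightarrow> r' = r0[k := True]" if "length r' = length w" "r' ! k"
  proof
    have "r'[k := True] = r'"
      using that(2) list_update_id[of r' k] by simp
    then show "r' = r0[k := True]" if "r'[k := False] = r0"
      using that by auto
    have "r0[k := False] = r0"
      using assms(3) list_update_id[of r0 k] by simp
    then show "r'[k := False] = r0" if "r' = r0[k := True]"
      using that by auto
  qed
  then show "diff_at x1 x2 n w s k (concentrated r0 t) r' = concentrated (r0[k := True]) (tscale (of_int (s r0 (r0[k := True])))
      (saddle x1 x2 n (layers w r0) (layers w (r0[k := True])) k (idx (w ! k)) t)) r'"
    using assms by (cases "length r' = length w \<and> r' ! k") (auto simp: diff_at_def concentrated_def Let_def)
qed

lemma diff_at_concentrated_zero:
  assumes "length r0 = length w" "k < length w"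
    and "\<not> r0 ! k \<Longrightarrow> saddle x1 x2 n (layers w r0) (layers w (r0[k := True])) k (idx (w ! k)) t = 0"
  shows "diff_at x1 x2 n w s k (concentrated r0 t) = 0"
proof (cases "r0 ! k")
  case True
  then have "r'[k := False] \<noteq> r0" if "length r' = length w" for r'
    using that assms(2) by auto
  then show ?thesis
    by (auto simp: diff_at_def concentrated_def Let_def fun_eq_iff tscale_apply)
next
  case False
  then show ?thesis
    using assms by (simp add: diff_at_concentrated) (simp add: concentrated_def fun_eq_iff)
qed

text \<open>
  A negative crossing is 1-resolved in the oriented resolution and so contributes
  nothing to the differential; a positive one merges two neighbouring strands.
\<close>

lemma diff_strand_chain:
  assumes "braid n w" "alternating x1 x2 f"
  shows "diff x1 x2 n w s (strand_chain n w f) = 0"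
  unfolding diff_def strand_chain_def
proof (intro sum.neutral ballI diff_at_concentrated_zero)
  fix k assume k: "k \<in> {..<length w}" and "\<not> oriented w ! k"
  then obtain i where i: "w ! k = Pos i"
    by (cases "w ! k") (auto simp: oriented_def)
  then have "1 \<le> i" "Suc i \<le> n"
    using assms(1) k nth_mem[of k w] by (fastforce simp: braid_def)+
  then show "saddle x1 x2 n (layers w (oriented w)) (layers w ((oriented w)[k := True])) k
      (idx (w ! k)) (strand_state n (vert (length w)) f) = 0"
    using strand_state_merge_zero[OF assms(2), of k "vert (length w)" i n] k i
    by (simp add: layers_update circ_vert)
qed simp_all

section \<open>Maps between stacks without caps\<close>

text \<open>
  The identifications of stacks used by the moves shift heights but preserve strands. One related pair of points on
  each strand is all that \<open>carry\<close> needs in order to find the strand.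
\<close>

definition keeps_strands :: "(point \<times> point) set \<Rightarrow> nat \<Rightarrow> nat \<Rightarrow> bool" where
  "keeps_strands \<rho> N N' \<longleftrightarrow> (\<forall>p q. (p, q) \<in> \<rho> \<longrightarrow> snd p = snd q) \<and>
     (\<forall>j. \<exists>k\<le>N. \<exists>k'\<le>N'. ((k, j), (k', j)) \<in> \<rho>)"

lemma keeps_strands_insertion: "keeps_strands (insertion a m) N N'"
  by (auto simp: keeps_strands_def insertion_def)

lemma keeps_strands_insertion': "keeps_strands ((insertion a m)\<inverse>) N N'"
  by (auto simp: keeps_strands_def insertion_def)

lemma keeps_strands_rotation: "a \<le> N \<Longrightarrow> keeps_strands (rotation a N) N N"
  unfolding keeps_strands_def rotation_def by fastforce

lemma keeps_strands_off_heights: "0 \<notin> K \<Longrightarrow> keeps_strands (off_heights K) N N'"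
  by (auto simp: keeps_strands_def off_heights_def)

lemma keeps_strands_Id: "keeps_strands Id N N'"
  by (auto simp: keeps_strands_def)

lemma carry_column:
  assumes "keeps_strands \<rho> N N'" "1 \<le> j" "j \<le> n"
  shows "carry n (vert N) \<rho> \<alpha> (column N' j) = \<alpha> (column N j)"
proof -
  define P where "P p \<longleftrightarrow> p \<in> points n (vert N) \<and> (\<exists>q\<in>column N' j. (p, q) \<in> \<rho>)" for p
  obtain k k' where "k \<le> N" "k' \<le> N'" "((k, j), (k', j)) \<in> \<rho>"
    using assms(1) unfolding keeps_strands_def by blast
  then have "P (k, j)"
    using assms by (auto simp: P_def points_def column_def)
  then have "P (SOME p. P p)"
    by (rule someI)
  moreover have "fst p \<le> N \<and> snd p = j" if p: "P p" for p
  proof -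
    obtain q where "p \<in> points n (vert N)" "q \<in> column N' j" "(p, q) \<in> \<rho>"
      using p unfolding P_def by blast
    moreover from this have "snd p = snd q"
      using assms(1) unfolding keeps_strands_def by blast
    ultimately show ?thesis
      by (auto simp: points_def column_def)
  qed
  ultimately have "fst (SOME p. P p) \<le> N \<and> snd (SOME p. P p) = j"
    by blast
  then obtain l where "(SOME p. P p) = (l, j)" "l \<le> N"
    by (cases "SOME p. P p") simp
  then show ?thesis
    using assms by (simp add: carry_def circ_vert flip: P_def)
qed

text \<open>
  The default label \<open>1\<close> off the circles of the stack comes from \<open>linear_ext_pure\<close>; the maps
  below do not look at it.
\<close>

lemma linear_ext_strands:
  assumes "\<And>j. 1 \<le> j \<Longrightarrow> j \<le> n \<Longrightarrow> slot_linear F (column N j)" "\<And>j. degree (f j) < 2"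
  shows "linear_ext (circles n (vert N)) F (strand_state n (vert N) f) =
    F (\<lambda>\<gamma>. if \<gamma> \<in> circles n (vert N) then f (strand \<gamma>) else 1)"
  unfolding strand_state_def using assms
  by (intro linear_ext_pure) (auto simp: circles_vert)

lemma transport_zero [simp]: "transport n fs n' fs' \<rho> 0 = 0"
  by (simp add: transport_def)

lemma column_in_circles: "1 \<le> j \<Longrightarrow> j \<le> n \<Longrightarrow> column N j \<in> circles n (vert N)"
  by (auto simp: circles_vert)

lemma pure_vert_update:
  assumes "1 \<le> j" "j \<le> n"
  shows "pure (circles n (vert N)) (\<alpha>(column N j := smult c a + smult d b)) =
    tscale c (pure (circles n (vert N)) (\<alpha>(column N j := a))) +
    tscale d (pure (circles n (vert N)) (\<alpha>(column N j := b)))"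
  using assms by (intro pure_linear finite_circles column_in_circles)

lemma carry_update:
  assumes "keeps_strands \<rho> N N'" "m \<le> n" "\<gamma> \<in> circles m (vert N')"
  shows "carry n (vert N) \<rho> (\<alpha>(column N j := z)) \<gamma> = ((carry n (vert N) \<rho> \<alpha>)(column N' j := z)) \<gamma>"
proof -
  obtain i where "\<gamma> = column N' i" "1 \<le> i" "i \<le> n"
    using assms(2,3) by (auto simp: circles_vert)
  then show ?thesis
    using assms(1) by (simp add: carry_column)
qed

lemma pure_carry_update:
  assumes "keeps_strands \<rho> N N'" "m \<le> n"
  shows "pure (circles m (vert N')) (carry n (vert N) \<rho> (\<alpha>(column N j := z))) =
    pure (circles m (vert N')) ((carry n (vert N) \<rho> \<alpha>)(column N' j := z))"
  using assms by (intro pure_cong carry_update)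

lemma transport_strands:
  assumes "keeps_strands \<rho> N N'" "\<And>j. degree (f j) < 2"
  shows "transport n (vert N) n (vert N') \<rho> (strand_state n (vert N) f) = strand_state n (vert N') f"
  unfolding transport_def using assms(2)
proof (subst linear_ext_strands)
  show "slot_linear (\<lambda>\<alpha>. pure (circles n (vert N')) (carry n (vert N) \<rho> \<alpha>)) (column N j)"
    if "1 \<le> j" "j \<le> n" for j
    using that by (simp add: slot_linear_def pure_carry_update[OF assms(1) order_refl] pure_vert_update)
  show "pure (circles n (vert N')) (carry n (vert N) \<rho>
      (\<lambda>\<gamma>. if \<gamma> \<in> circles n (vert N) then f (strand \<gamma>) else 1)) = strand_state n (vert N') f"
    using assms(1) by (intro strand_state_vert_cong) (simp add: carry_column column_in_circles)
qed

lemma death_strands: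
  assumes "keeps_strands \<rho> N N'" "\<And>j. degree (f j) < 2"
  shows "death (Suc n) (vert N) n (vert N') \<rho> (column N (Suc n)) (strand_state (Suc n) (vert N) f) =
    tscale (counit (f (Suc n))) (strand_state n (vert N') f)"
  unfolding death_def using assms(2)
proof (subst linear_ext_strands)
  have out: "pure (circles n (vert N')) (\<alpha>(column N' (Suc n) := z)) = pure (circles n (vert N')) \<alpha>" for \<alpha> z
    by (intro pure_cong) (auto simp: circles_vert)
  show "slot_linear (\<lambda>\<alpha>. tscale (counit (\<alpha> (column N (Suc n))))
      (pure (circles n (vert N')) (carry (Suc n) (vert N) \<rho> \<alpha>))) (column N j)"
    if "1 \<le> j" "j \<le> Suc n" for j
  proof (cases "j = Suc n")
    case True
    then show ?thesis
      by (simp add: slot_linear_def pure_carry_update[OF assms(1) le_SucI[OF order_refl]] out counit_def fun_eq_iff tscale_apply algebra_simps)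
  next
    case False
    then show ?thesis
      using that by (simp add: slot_linear_def pure_carry_update[OF assms(1) le_SucI[OF order_refl]] pure_vert_update) (simp add: fun_eq_iff tscale_apply algebra_simps)
  qed
  have "pure (circles n (vert N')) (carry (Suc n) (vert N) \<rho>
      (\<lambda>\<gamma>. if \<gamma> \<in> circles (Suc n) (vert N) then f (strand \<gamma>) else 1)) = strand_state n (vert N') f"
    using assms(1) by (intro strand_state_vert_cong) (simp add: carry_column column_in_circles)
  then show "tscale (counit (if column N (Suc n) \<in> circles (Suc n) (vert N)
        then f (strand (column N (Suc n))) else 1))
      (pure (circles n (vert N')) (carry (Suc n) (vert N) \<rho>
        (\<lambda>\<gamma>. if \<gamma> \<in> circles (Suc n) (vert N) then f (strand \<gamma>) else 1))) =
    tscale (counit (f (Suc n))) (strand_state n (vert N') f)"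
    by (simp add: column_in_circles)
qed

lemma birth_strands:
  fixes f :: "nat \<Rightarrow> 'r::comm_ring_1 poly"
  assumes "keeps_strands \<rho> N N'" "\<And>j. degree (f j) < 2"
  shows "birth n (vert N) (Suc n) (vert N') \<rho> (column N' (Suc n)) (strand_state n (vert N) f) =
    strand_state (Suc n) (vert N') (f(Suc n := 1))"
  unfolding birth_def using assms(2)
proof (subst linear_ext_strands)
  show "slot_linear (\<lambda>\<alpha> :: 'r labelling. pure (circles (Suc n) (vert N'))
      ((carry n (vert N) \<rho> \<alpha>)(column N' (Suc n) := 1))) (column N j)" if "1 \<le> j" "j \<le> n" for j
  proof -
    have "pure (circles (Suc n) (vert N')) ((carry n (vert N) \<rho> (\<alpha>(column N j := z)))(column N' (Suc n) := 1)) =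
        pure (circles (Suc n) (vert N')) ((carry n (vert N) \<rho> \<alpha>)(column N' (Suc n) := 1, column N' j := z))"
      for \<alpha> :: "'r labelling" and z
    proof (intro pure_cong)
      fix \<gamma> assume "\<gamma> \<in> circles (Suc n) (vert N')"
      then obtain i where "\<gamma> = column N' i" "1 \<le> i" "i \<le> n \<or> i = Suc n"
        by (auto simp: circles_vert le_Suc_eq)
      then show "((carry n (vert N) \<rho> (\<alpha>(column N j := z)))(column N' (Suc n) := 1)) \<gamma> =
          ((carry n (vert N) \<rho> \<alpha>)(column N' (Suc n) := 1, column N' j := z)) \<gamma>"
        using assms(1) that by (auto simp: carry_column simp del: One_nat_def)
    qed
    then show ?thesis
      using that by (simp add: slot_linear_def pure_vert_update)
  qed
  show "pure (circles (Suc n) (vert N')) ((carry n (vert N) \<rho>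
      (\<lambda>\<gamma>. if \<gamma> \<in> circles n (vert N) then f (strand \<gamma>) else 1))(column N' (Suc n) := 1)) =
    strand_state (Suc n) (vert N') (f(Suc n := 1))"
    using assms(1) by (intro strand_state_vert_cong) (auto simp: carry_column column_in_circles le_Suc_eq)
qed

section \<open>Planar isotopies and second moves\<close>

text \<open>
  The maps of the moves cut resolutions into pieces and reassemble them; this is what identifies
  the component of the oriented resolution.
\<close>

lemma append_oriented_iff:
  assumes "length r = length u"
  shows "r @ r' = oriented (u @ v) \<longleftrightarrow> r = oriented u \<and> r' = oriented v"
  using assms by (simp add: oriented_def append_eq_append_conv)

lemma conj_map_strands:
  assumes "oriented_signs (v @ u) \<eta>" "\<And>j. degree (f j) < 2"
  shows "conj_map n u v \<eta> (strand_chain n (u @ v) f) = strand_chain n (v @ u) f"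
proof
  fix r' :: "bool list"
  let ?r = "drop (length v) r' @ take (length v) r'"
  show "conj_map n u v \<eta> (strand_chain n (u @ v) f) r' = strand_chain n (v @ u) f r'"
  proof (cases "length r' = length (v @ u)")
    case True
    have "?r = oriented (u @ v) \<longleftrightarrow> take (length v) r' @ drop (length v) r' = oriented (v @ u)"
      using True by (subst (1 2) append_oriented_iff) auto
    then have "?r = oriented (u @ v) \<longleftrightarrow> r' = oriented (v @ u)"
      by simp
    then show ?thesis
      using assms True transport_strands[OF keeps_strands_rotation, of "length u" "length (u @ v)" f n]
      by (auto simp: conj_map_def strand_chain_apply Let_def oriented_signs_def add.commute)
  next
    case False
    then have "r' \<noteq> oriented (v @ u)"
      by auto
    then show ?thesis
      using False by (simp add: conj_map_def strand_chain_apply)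
  qed
qed

lemma far_map_strands:
  assumes "oriented_signs (u @ [c', c] @ v) \<eta>" "\<And>j. degree (f j) < 2"
  shows "far_map n u c c' v \<eta> (strand_chain n (u @ [c, c'] @ v) f) = strand_chain n (u @ [c', c] @ v) f"
proof
  fix r' :: "bool list"
  let ?a = "length u"
  let ?r = "r'[?a := r' ! Suc ?a, Suc ?a := r' ! ?a]"
  show "far_map n u c c' v \<eta> (strand_chain n (u @ [c, c'] @ v) f) r' = strand_chain n (u @ [c', c] @ v) f r'"
  proof (cases "length r' = length (u @ [c', c] @ v)")
    case True
    \<comment> \<open>Exchanging two entries is an involution, so it is enough to follow the oriented resolution in each direction.\<close>
    have swap: "(oriented (u @ [d', d] @ v))[?a := oriented (u @ [d', d] @ v) ! Suc ?a,
        Suc ?a := oriented (u @ [d', d] @ v) ! ?a] = oriented (u @ [d, d'] @ v)" for d d'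
      by (simp add: oriented_def nth_append list_update_append)
    have "r' = ?r[?a := ?r ! Suc ?a, Suc ?a := ?r ! ?a]"
      using True by (intro nth_equalityI) (auto simp: nth_list_update)
    then have "?r = oriented (u @ [c, c'] @ v) \<longleftrightarrow> r' = oriented (u @ [c', c] @ v)"
      using swap[of c c'] swap[of c' c] by metis
    then show ?thesis
      using assms True transport_strands[OF keeps_strands_off_heights, of "{Suc ?a}" f n
          "length (u @ [c, c'] @ v)" "length (u @ [c, c'] @ v)"]
      by (auto simp: far_map_def strand_chain_apply Let_def oriented_signs_def)
  next
    case False
    then have "r' \<noteq> oriented (u @ [c', c] @ v)"
      by (auto simp: oriented_def)
    then show ?thesis
      using False by (simp add: far_map_def strand_chain_apply)
  qed
qed

text \<open>
  The saddle along \<open>e\<close> merges two parallel strands, which carry opposite labels.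
\<close>

lemma arc_e_strands:
  assumes "alternating x1 x2 f" "1 \<le> i" "Suc i \<le> n"
  shows "arc_e x1 x2 n (vert a) i (vert b) (strand_state n (vert (a + b)) f) = 0"
proof -
  have f1: "vert a @ [Vert] @ vert b = vert (Suc (a + b))"
    using replicate_add[of a "Suc b" Vert] by simp
  have f2: "vert a @ [Cupcap i] @ vert b = (vert a @ [Vert] @ vert b)[a := Cupcap i]"
    by (simp add: list_update_append)
  have "saddle x1 x2 n (vert (Suc (a + b))) ((vert (Suc (a + b)))[a := Cupcap i]) a i
      (strand_state n (vert (Suc (a + b))) f) = 0"
    using assms by (intro strand_state_merge_zero) (simp_all add: circ_vert del: replicate_Suc)
  moreover have "transport n (vert (a + b)) n (vert (Suc (a + b))) (insertion a 1)
      (strand_state n (vert (a + b)) f) = strand_state n (vert (Suc (a + b))) f"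
    by (intro transport_strands keeps_strands_insertion alternating_degree[OF assms(1)])
  ultimately show ?thesis
    unfolding arc_e_def Let_def f2 f1 length_replicate replicate_add[symmetric]
    by (simp only: birth_def linear_ext_zero)
qed

lemma arc_g_zero [simp]: "arc_g x1 x2 n fu i fv 0 = 0"
  by (simp add: arc_g_def Let_def death_def)

lemma arc_e_zero [simp]: "arc_e x1 x2 n fu i fv 0 = 0"
  by (simp add: arc_e_def Let_def birth_def)

text \<open>
  Where both new crossings have the oriented resolution, the map is a transport of strands; where
  both have the other one, there is the small circle, and the component vanishes by
  \<open>arc_e_strands\<close>.
\<close>

lemma psi2_strands:
  assumes "alternating x1 x2 f" "oriented_signs (u @ [c, c'] @ v) \<eta>" "1 \<le> idx c" "Suc (idx c) \<le> n"
  shows "psi2 x1 x2 n u c c' v \<eta> (strand_chain n (u @ v) f) = strand_chain n (u @ [c, c'] @ v) f"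
proof
  fix r' :: "bool list"
  let ?a = "length u"
  let ?ru = "take ?a r'" and ?rv = "drop (Suc (Suc ?a)) r'"
  have deg: "degree (f j) < 2" for j
    using assms(1) by (rule alternating_degree)
  let ?L = "length (u @ [c, c'] @ v)"
  show "psi2 x1 x2 n u c c' v \<eta> (strand_chain n (u @ v) f) r' = strand_chain n (u @ [c, c'] @ v) f r'"
  proof (cases "length r' = length (u @ [c, c'] @ v)")
    case True
    have r': "r' = ?ru @ [r' ! ?a, r' ! Suc ?a] @ ?rv"
      using True by (simp add: Cons_nth_drop_Suc)
    have "?ru @ [r' ! ?a, r' ! Suc ?a] @ ?rv = oriented (u @ [c, c'] @ v) \<longleftrightarrow>
        ?ru = oriented u \<and> [r' ! ?a, r' ! Suc ?a] @ ?rv = oriented ([c, c'] @ v)"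
      using True by (intro append_oriented_iff) auto
    then have o': "r' = oriented (u @ [c, c'] @ v) \<longleftrightarrow> 
        ?ru = oriented u \<and> ?rv = oriented v \<and> r' ! ?a = is_Neg c \<and> r' ! Suc ?a = is_Neg c'"
      unfolding r'[symmetric] by (auto simp: oriented_def)
    have o: "?ru @ ?rv = oriented (u @ v) \<longleftrightarrow> ?ru = oriented u \<and> ?rv = oriented v"
      using True by (intro append_oriented_iff) auto
    let ?in = "strand_chain n (u @ v) f (?ru @ ?rv)"
    have val: "psi2 x1 x2 n u c c' v \<eta> (strand_chain n (u @ v) f) r' = tscale (of_int (\<eta> r'))
        (if r' ! ?a = is_Neg c \<and> r' ! Suc ?a = is_Neg c'
         then transport n (layers (u @ v) (?ru @ ?rv)) n (layers (u @ [c, c'] @ v) r') (insertion ?a 2) ?in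
         else if r' ! ?a \<noteq> is_Neg c \<and> r' ! Suc ?a \<noteq> is_Neg c'
         then arc_e x1 x2 n (layers u ?ru) (idx c) (layers v ?rv) ?in else 0)"
      unfolding psi2_def Let_def using True by (simp only: if_True simp_thms)
    show ?thesis
    proof (cases "?ru = oriented u \<and> ?rv = oriented v")
      case False
      then have "?in = 0" "strand_chain n (u @ [c, c'] @ v) f r' = 0"
        unfolding strand_chain_apply o o' by auto
      then show ?thesis
        unfolding val by simp
    next
      case or: True
      then have ruv: "?ru @ ?rv = oriented (u @ v)"
        using o by blast
      have "?in = strand_state n (vert (length u + length v)) f"
        unfolding ruv strand_chain_apply by simp
      then have arc: "arc_e x1 x2 n (layers u ?ru) (idx c) (layers v ?rv) ?in = 0"
        using or assms arc_e_strands by (metis layers_oriented)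
      show ?thesis
      proof (cases "r' ! ?a = is_Neg c \<and> r' ! Suc ?a = is_Neg c'")
        case True
        then have r'o: "r' = oriented (u @ [c, c'] @ v)"
          using or o' by simp
        have "psi2 x1 x2 n u c c' v \<eta> (strand_chain n (u @ v) f) r' =
            transport n (vert (length (u @ v))) n (vert ?L) (insertion ?a 2) (strand_state n (vert (length (u @ v))) f)"
          unfolding val ruv using True assms(2) r'o by (simp add: strand_chain_apply oriented_signs_def del: append_Cons append_Nil)
        also have "\<dots> = strand_state n (vert ?L) f"
          using deg by (intro transport_strands keeps_strands_insertion)
        finally show ?thesis
          by (simp add: r'o strand_chain_apply del: append_Cons append_Nil)
      next
        case False
        then have "strand_chain n (u @ [c, c'] @ v) f r' = 0"
          unfolding strand_chain_apply o' by auto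
        then show ?thesis
          unfolding val arc if_not_P[OF False] by simp
      qed
    qed
  next
    case False
    then have "r' \<noteq> oriented (u @ [c, c'] @ v)"
      by (auto simp: oriented_def)
    then show ?thesis
      using False by (simp add: psi2_def strand_chain_apply)
  qed
qed

text \<open>
  The saddle term only sees the resolution with the small circle, where the chain
  vanishes.
\<close>

lemma phi2_strands:
  assumes "\<And>j. degree (f j) < 2" "oriented_signs (u @ [c, c'] @ v) \<eta>"
  shows "phi2 x1 x2 n u c c' v \<eta> (strand_chain n (u @ [c, c'] @ v) f) = strand_chain n (u @ v) f"
proof
  fix r :: "bool list"
  let ?a = "length u"
  let ?ru = "take ?a r" and ?rv = "drop ?a r"
  show "phi2 x1 x2 n u c c' v \<eta> (strand_chain n (u @ [c, c'] @ v) f) r = strand_chain n (u @ v) f r"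
  proof (cases "length r = length (u @ v)")
    case True
    have o': "?ru @ [b, b'] @ ?rv = oriented (u @ [c, c'] @ v) \<longleftrightarrow>
        ?ru = oriented u \<and> b = is_Neg c \<and> b' = is_Neg c' \<and> ?rv = oriented v" for b b'
      using True by (subst append_oriented_iff) (auto simp: oriented_def)
    have "?ru @ ?rv = oriented (u @ v) \<longleftrightarrow> ?ru = oriented u \<and> ?rv = oriented v"
      using True by (intro append_oriented_iff) auto
    then have o: "r = oriented (u @ v) \<longleftrightarrow> ?ru = oriented u \<and> ?rv = oriented v"
      by simp
    have r01: "strand_chain n (u @ [c, c'] @ v) f (?ru @ [\<not> is_Neg c, \<not> is_Neg c'] @ ?rv) = 0"
      unfolding strand_chain_apply o' by simp
    have r10: "strand_chain n (u @ [c, c'] @ v) f (?ru @ [is_Neg c, is_Neg c'] @ ?rv) =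
        (if r = oriented (u @ v) then strand_state n (vert (length (u @ [c, c'] @ v))) f else 0)"
      unfolding strand_chain_apply o' o by simp
    have tr: "transport n (vert (length (u @ [c, c'] @ v))) n (vert (length (u @ v))) ((insertion ?a 2)\<inverse>)
        (strand_state n (vert (length (u @ [c, c'] @ v))) f) = strand_state n (vert (length (u @ v))) f"
      using assms(1) by (intro transport_strands keeps_strands_insertion')
    show ?thesis
    proof (cases "r = oriented (u @ v)")
      case o1: True
      then have "?ru @ [is_Neg c, is_Neg c'] @ ?rv = oriented (u @ [c, c'] @ v)"
        using o o' by simp
      then have "layers (u @ [c, c'] @ v) (?ru @ [is_Neg c, is_Neg c'] @ ?rv) = vert (length (u @ [c, c'] @ v))"
          "\<eta> (?ru @ [is_Neg c, is_Neg c'] @ ?rv) = 1"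
        using assms(2) unfolding oriented_signs_def by (metis layers_oriented)+
      moreover have "layers (u @ v) r = vert (length (u @ v))"
        unfolding o1 by (rule layers_oriented)
      ultimately show ?thesis
        unfolding phi2_def Let_def r01 r10 using o1 True tr by (simp only: strand_chain_apply) simp
    next
      case False
      then show ?thesis
        unfolding phi2_def Let_def r01 r10 using True by (simp add: strand_chain_apply)
    qed
  next
    case False
    then have "r \<noteq> oriented (u @ v)"
      by auto
    then show ?thesis
      using False by (simp add: phi2_def strand_chain_apply)
  qed
qed

lemma psi2_map_strands:
  assumes "alternating x1 x2 f" "1 \<le> idx c" "Suc (idx c) \<le> n" "psi2_map x1 x2 n u c c' v s s' \<Psi>"
  shows "\<Psi> (strand_chain n (u @ v) f) = strand_chain n (u @ [c, c'] @ v) f"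
  using assms(4) psi2_strands[OF assms(1) _ assms(2,3)] unfolding psi2_map_def by (elim conjE exE) simp

lemma phi2_map_strands:
  assumes "alternating x1 x2 f" "phi2_map x1 x2 n u c c' v s s' \<Phi>"
  shows "\<Phi> (strand_chain n (u @ [c, c'] @ v) f) = strand_chain n (u @ v) f"
proof -
  obtain \<eta> where "oriented_signs (u @ [c, c'] @ v) \<eta>" "\<Phi> = phi2 x1 x2 n u c c' v \<eta>"
    using assms(2) unfolding phi2_map_def by (elim conjE exE)
  then show ?thesis
    by (simp only: phi2_strands alternating_degree[OF assms(1)])
qed

section \<open>Third moves\<close>

text \<open>
  A positive crossing is 0-resolved in the oriented resolution, so the oriented resolution of the
  diagram lies in the part of the cone that is the complex of the diagram without the crossing.
\<close>

lemma insert_oriented_iff: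
  assumes "k < length w" "w ! k = Pos i" "length r = length w - 1"
  shows "insert_at k False r = oriented w \<longleftrightarrow> r = oriented (delete_at k w)"
proof -
  have w: "w = take k w @ [Pos i] @ drop (Suc k) w"
    using assms(1,2) by (metis append_Cons append_Nil id_take_nth_drop)
  have 1: "insert_at k False r = oriented w \<longleftrightarrow>
      take k r = oriented (take k w) \<and> drop k r = oriented (drop (Suc k) w)"
    unfolding insert_at_def by (subst w, subst append_oriented_iff) (use assms in \<open>auto simp: oriented_def\<close>)
  have "take k r @ drop k r = oriented (delete_at k w) \<longleftrightarrow>
      take k r = oriented (take k w) \<and> drop k r = oriented (drop (Suc k) w)"
    unfolding delete_at_def by (rule append_oriented_iff) (use assms in auto)
  with 1 show ?thesis
    by simp
qed

lemma length_delete_at [simp]: "k < length w \<Longrightarrow> length (delete_at k w) = length w - 1"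
  by (simp add: delete_at_def)

lemma part0_strands:
  assumes "k < length w" "w ! k = Pos i" "\<And>j. degree (f j) < 2"
  shows "part0 n w k (strand_chain n w f) = strand_chain n (delete_at k w) f"
proof
  fix r :: "bool list"
  show "part0 n w k (strand_chain n w f) r = strand_chain n (delete_at k w) f r"
  proof (cases "Suc (length r) = length w")
    case True
    then have ins: "insert_at k False r = oriented w \<longleftrightarrow> r = oriented (delete_at k w)"
      using assms by (intro insert_oriented_iff) auto
    then have "r = oriented (delete_at k w) \<Longrightarrow> layers w (insert_at k False r) = vert (length w)"
      using layers_oriented by metis
    moreover have "r = oriented (delete_at k w) \<Longrightarrow> layers (delete_at k w) r = vert (length w - 1)"
      using assms(1) by simp
    ultimately show ?thesis
      using True ins assms(1) transport_strands[OF keeps_strands_insertion' assms(3)]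
      by (simp add: part0_def Let_def strand_chain_apply)
  next
    case False
    then have "r \<noteq> oriented (delete_at k w)"
      using assms(1) by auto
    then show ?thesis
      using False by (simp add: part0_def strand_chain_apply)
  qed
qed

lemma incl0_strands:
  assumes "k < length w" "w ! k = Pos i" "\<And>j. degree (f j) < 2"
  shows "incl0 n w k (strand_chain n (delete_at k w) f) = strand_chain n w f"
proof
  fix r :: "bool list"
  show "incl0 n w k (strand_chain n (delete_at k w) f) r = strand_chain n w f r"
  proof (cases "length r = length w \<and> \<not> r ! k")
    case True
    have "insert_at k False (delete_at k r) = r"
      using True assms(1) id_take_nth_drop[of k r] by (simp add: insert_at_def delete_at_def)
    then have ins: "delete_at k r = oriented (delete_at k w) \<longleftrightarrow> r = oriented w"
      using insert_oriented_iff[of k w i "delete_at k r"] assms True by simp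
    then have "r = oriented w \<Longrightarrow> layers (delete_at k w) (delete_at k r) = vert (length w - 1)"
      using layers_oriented length_delete_at[OF assms(1)] by metis
    then show ?thesis
      using True ins assms(1) transport_strands[OF keeps_strands_insertion assms(3)]
      by (simp add: incl0_def Let_def strand_chain_apply)
  next
    case False
    then have "r \<noteq> oriented w"
      using assms(1,2) by (auto simp: oriented_def)
    then show ?thesis
      using False by (auto simp: incl0_def strand_chain_apply)
  qed
qed

lemma part1_strands:
  assumes "k < length w" "w ! k = Pos i"
  shows "part1 n w k (strand_chain n w f) = 0"
  using assms by (auto simp: part1_def strand_chain_apply oriented_def fun_eq_iff)

lemma incl0_zero: "incl0 n w k 0 = 0"
  by (auto simp: incl0_def Let_def fun_eq_iff)

lemma top_iso_zero: "top_iso n w w' k \<eta> 0 = 0"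
  by (auto simp: top_iso_def Let_def fun_eq_iff tscale_apply)

text \<open>
  The map to the cone has the components \<open>f\<close> and \<open>y \<plusminus> S h x\<close>. On the chain in question \<open>y = 0\<close>, and \<open>x\<close>
  is the image under \<open>g\<close> of the corresponding chain of \<open>u @ v\<close>, so \<open>h x = 0\<close> by \<open>h g = 0\<close>. What is left is
  a cancelling second move followed by an inserting one.
\<close>

lemma r3_map_strands:
  assumes alt: "alternating x1 x2 f" and "braid n (u @ [c1, c, c2] @ v)"
    and sides: "r3_sides (c1, c, c2) (c1', c', c2')"
    and r3: "r3_map x1 x2 n u (c1, c, c2) (c1', c', c2') v s s' \<Psi>"
  shows "\<Psi> (strand_chain n (u @ [c1, c, c2] @ v) f) = strand_chain n (u @ [c1', c', c2'] @ v) f"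
proof -
  let ?w = "u @ [c1, c, c2] @ v" and ?w' = "u @ [c1', c', c2'] @ v" and ?w'' = "u @ v"
  let ?k = "Suc (length u)"
  have deg: "degree (f j) < 2" for j
    using alt by (rule alternating_degree)
  obtain i where i: "{(c1, c, c2), (c1', c', c2')} =
      {(Neg (Suc i), Pos i, Pos (Suc i)), (Pos i, Pos (Suc i), Neg i)}"
    using sides unfolding r3_sides_def by (elim exE)
  then have "(c1, c, c2) \<in> {(Neg (Suc i), Pos i, Pos (Suc i)), (Pos i, Pos (Suc i), Neg i)}"
    and "(c1', c', c2') \<in> {(Neg (Suc i), Pos i, Pos (Suc i)), (Pos i, Pos (Suc i), Neg i)}"
    unfolding i[symmetric] by simp_all
  then have pos: "c \<in> range Pos" "c' \<in> range Pos"
    and idx: "idx c1 = i \<or> idx c = i" "idx c1 = Suc i \<or> idx c = Suc i"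
      "idx c1 = i \<or> idx c1 = Suc i" "idx c1' = i \<or> idx c1' = Suc i"
    by auto
  have "1 \<le> idx c1 \<and> idx c1 < n \<and> 1 \<le> idx c \<and> idx c < n"
    using assms(2) by (simp add: braid_def)
  then have "1 \<le> i" "Suc i < n"
    using idx(1,2) by auto
  then have range: "1 \<le> idx c1" "Suc (idx c1) \<le> n" "1 \<le> idx c1'" "Suc (idx c1') \<le> n"
    using idx by auto
  have len: "?k < length ?w" "?k < length ?w'"
    by simp_all
  have nth: "?w ! ?k = c" "?w' ! ?k = c'"
    by (simp_all add: nth_append)
  have del: "delete_at ?k ?w = u @ [c1, c2] @ v" "delete_at ?k ?w' = u @ [c1', c2'] @ v"
    by (simp_all add: delete_at_def)
  obtain s'' f' g h g0 \<kappa> \<eta> where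
    f': "phi2_map x1 x2 n u c1 c2 v (sign0 ?k s) s'' f'" and
    g: "psi2_map x1 x2 n u c1 c2 v s'' (sign0 ?k s) g" and
    g0: "psi2_map x1 x2 n u c1' c2' v s'' (sign0 ?k s') g0" and
    h: "retraction_homotopy x1 x2 n (delete_at ?k ?w) (sign0 ?k s) ?w'' f' g h" and
    \<Psi>: "\<Psi> = (\<lambda>x. from_cone n ?w' ?k g0 (map_prod id (top_iso n ?w ?w' ?k \<eta>) (to_cone x1 x2 n ?w s ?k f' h \<kappa> x)))"
    using r3 unfolding r3_map_def Let_def by auto
  have f'_state: "f' (strand_chain n (u @ [c1, c2] @ v) f) = strand_chain n ?w'' f"
    using phi2_map_strands[OF alt f'] .
  have g_state: "g (strand_chain n ?w'' f) = strand_chain n (u @ [c1, c2] @ v) f"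
    using psi2_map_strands[OF alt range(1,2) g] .
  have g0_state: "g0 (strand_chain n ?w'' f) = strand_chain n (u @ [c1', c2'] @ v) f"
    using psi2_map_strands[OF alt range(3,4) g0] .
  \<comment> \<open>The homotopy is controlled on the image of \<open>g\<close> only.\<close>
  have "h (g (strand_chain n ?w'' f)) = 0"
    using h strand_chain_in_chains[of n ?w'' f] unfolding retraction_homotopy_def by (elim conjE) simp
  then have h_state: "h (strand_chain n (u @ [c1, c2] @ v) f) = 0"
    by (simp only: g_state)
  obtain a a' where "c = Pos a" "c' = Pos a'"
    using pos by auto
  then have
    p0: "part0 n ?w ?k (strand_chain n ?w f) = strand_chain n (u @ [c1, c2] @ v) f" and
    p1: "part1 n ?w ?k (strand_chain n ?w f) = 0" and
    i0: "incl0 n ?w' ?k (strand_chain n (u @ [c1', c2'] @ v) f) = strand_chain n ?w' f"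
    using part0_strands[OF len(1), of a f n] part1_strands[OF len(1), of a n f]
      incl0_strands[OF len(2), of a' f n] nth deg del by simp_all
  have "to_cone x1 x2 n ?w s ?k f' h \<kappa> (strand_chain n ?w f) = (strand_chain n ?w'' f, 0)"
    unfolding to_cone_def p0 p1 f'_state h_state incl0_zero diff_at_zero
    by (simp add: cscale_def fun_eq_iff tscale_apply)
  then show ?thesis
    unfolding \<Psi> by (simp only: map_prod_simp id_apply top_iso_zero from_cone_def split_conv g0_state i0 add_0_right)
qed

section \<open>Stabilizations\<close>

lemma comult_at_slot_linear:
  fixes x1 x2 :: "'r::comm_ring_1"
  assumes "finite \<Gamma>" "l \<in> \<Gamma>" "l \<noteq> g" "l \<noteq> h"
  shows "slot_linear (comult_at x1 x2 \<Gamma> g h a) l"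
proof -
  have "pure \<Gamma> (\<alpha>(l := smult c b + smult d b', g := p, h := q)) =
      tscale c (pure \<Gamma> (\<alpha>(l := b, g := p, h := q))) + tscale d (pure \<Gamma> (\<alpha>(l := b', g := p, h := q)))"
    for \<alpha> :: "'r labelling" and b b' c d p q
    using pure_linear[OF assms(1,2), of "\<alpha>(g := p, h := q)"] assms(3,4) by (simp add: fun_upd_twist)
  then show ?thesis
    unfolding slot_linear_def comult_at_def comult_def by simp (simp add: fun_eq_iff tscale_apply algebra_simps)
qed

lemma comult_at_cong:
  assumes "\<And>\<gamma>. \<gamma> \<in> \<Gamma> \<Longrightarrow> \<gamma> \<noteq> g \<Longrightarrow> \<gamma> \<noteq> h \<Longrightarrow> \<alpha> \<gamma> = \<beta> \<gamma>"
  shows "comult_at x1 x2 \<Gamma> g h a \<alpha> = comult_at x1 x2 \<Gamma> g h a \<beta>"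
proof -
  have "pure \<Gamma> (\<alpha>(g := p, h := q)) = pure \<Gamma> (\<beta>(g := p, h := q))" for p q
    using assms by (intro pure_cong) simp
  then show ?thesis
    by (simp only: comult_at_def)
qed

lemma comult_at_strands:
  assumes "alternating x1 x2 f" "1 \<le> n"
    and "\<And>j. 1 \<le> j \<Longrightarrow> j < n \<Longrightarrow> \<alpha> (column N j) = f j"
  shows "comult_at x1 x2 (circles (Suc n) (vert N)) (column N n) (column N (Suc n)) (f n) \<alpha> =
    strand_state (Suc n) (vert N) (f(Suc n := f n))"
proof -
  have "opposite x1 x2 (f n) (f (Suc n))"
    using assms(1) by (simp add: alternating_def)
  then have "comult_at x1 x2 (circles (Suc n) (vert N)) (column N n) (column N (Suc n)) (f n) \<alpha> =
      pure (circles (Suc n) (vert N)) (\<alpha>(column N n := f n, column N (Suc n) := f n))"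
    using assms(2) by (intro comult_at_opposite finite_circles column_in_circles) auto
  also have "\<dots> = strand_state (Suc n) (vert N) (f(Suc n := f n))"
    using assms(3) by (intro strand_state_vert_cong) (auto simp: le_Suc_eq less_le)
  finally show ?thesis .
qed

lemma strand_state_last_linear:
  "strand_state (Suc n) (vert N) (f(Suc n := smult c a + smult d b)) =
    tscale c (strand_state (Suc n) (vert N) (f(Suc n := a))) +
    tscale d (strand_state (Suc n) (vert N) (f(Suc n := b)))"
proof -
  have "strand_state (Suc n) (vert N) (f(Suc n := z)) =
      pure (circles (Suc n) (vert N)) ((\<lambda>\<gamma>. f (strand \<gamma>))(column N (Suc n) := z))" for z
    by (rule strand_state_vert_cong[symmetric]) simp
  then show ?thesis
    by (simp add: pure_vert_update)
qed

lemma new_circle_vert: "new_circle n (vert N) = column N (Suc n)"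
  by (simp add: new_circle_def circ_vert)

lemma append_last_oriented:
  "length r = length w \<Longrightarrow> r @ [b] = oriented (w @ [c]) \<longleftrightarrow> r = oriented w \<and> b = is_Neg c"
  by (subst append_oriented_iff) (auto simp: oriented_def)

lemma butlast_oriented:
  assumes "r' = oriented (w @ [c])"
  shows "butlast r' = oriented w" "last r' = is_Neg c"
  using assms by (simp_all add: oriented_def)

lemma oriented_lastI:
  assumes "length r' = Suc (length w)" "last r' = is_Neg c" "butlast r' = oriented w"
  shows "r' = oriented (w @ [c])"
proof -
  have "r' = butlast r' @ [last r']"
    using assms(1) by (metis append_butlast_last_id length_0_conv nat.distinct(1))
  then show ?thesis
    using assms by (simp add: oriented_def)
qed

text \<open>
  With \<open>a\<close> the label of the strand \<open>n\<close> and \<open>b\<close> its opposite, the map replaces \<open>a\<close> by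
  \<open>a \<otimes> (a + b) - a \<otimes> a = a \<otimes> b\<close>. Most of the proof checks that the map is linear in
  each label; in the second summand the label of the strand \<open>n\<close> enters through the coproduct only.
\<close>

lemma phi1_pos_strands:
  assumes alt: "alternating x1 x2 f" and "oriented_signs (w @ [Pos n]) \<eta>" "1 \<le> n"
  shows "phi1_pos x1 x2 n w \<eta> (strand_chain n w f) = strand_chain (Suc n) (w @ [Pos n]) f"
proof
  fix r' :: "bool list"
  define N where "N = length w"
  define \<Gamma>' where "\<Gamma>' = circles (Suc n) (vert (Suc N))"
  define g h where "g = column (Suc N) n" and "h = column (Suc N) (Suc n)"
  define ca where "ca = (carry n (vert N) Id :: 'a labelling \<Rightarrow> 'a labelling)"
  define F where "F = (\<lambda>\<alpha>. pure \<Gamma>' ((ca \<alpha>)(h := x_white x1 + x_black x2)) - comult_at x1 x2 \<Gamma>' g h (\<alpha> (column N n)) (ca \<alpha>))"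
  have gh: "g \<noteq> h" "g \<in> \<Gamma>'" "h \<in> \<Gamma>'" "finite \<Gamma>'"
    using assms(3) by (auto simp: g_def h_def \<Gamma>'_def column_in_circles finite_circles simp del: replicate_Suc)
  have ca: "ca \<alpha> (column (Suc N) j) = \<alpha> (column N j)" if "1 \<le> j" "j \<le> n" for \<alpha> j
    using that by (simp only: ca_def carry_column keeps_strands_Id)
  have F_value: "F (\<lambda>\<gamma>. if \<gamma> \<in> circles n (vert N) then f (strand \<gamma>) else 1) =
      strand_state (Suc n) (vert (Suc N)) f"
  proof -
    let ?\<alpha> = "\<lambda>\<gamma>. if \<gamma> \<in> circles n (vert N) then f (strand \<gamma>) else 1"
    have lab: "ca ?\<alpha> (column (Suc N) j) = f j" if "1 \<le> j" "j \<le> n" for j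
      using that by (simp add: ca column_in_circles)
    have "x_white x1 + x_black x2 = f n + f (Suc n)"
      using alt unfolding alternating_def opposite_def by (metis add.commute)
    then have "pure \<Gamma>' ((ca ?\<alpha>)(h := x_white x1 + x_black x2)) =
        strand_state (Suc n) (vert (Suc N)) (f(Suc n := smult 1 (f n) + smult 1 (f (Suc n))))"
      unfolding \<Gamma>'_def h_def using lab by (intro strand_state_vert_cong) (auto simp: le_Suc_eq)
    moreover have "comult_at x1 x2 \<Gamma>' g h (?\<alpha> (column N n)) (ca ?\<alpha>) =
        strand_state (Suc n) (vert (Suc N)) (f(Suc n := f n))"
      using comult_at_strands[OF alt assms(3), of "ca ?\<alpha>" "Suc N"] lab assms(3)
      by (simp add: \<Gamma>'_def g_def h_def column_in_circles del: replicate_Suc)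
    ultimately show ?thesis
      unfolding F_def strand_state_last_linear by simp
  qed
  have slots: "slot_linear F (column N j)" if j: "1 \<le> j" "j \<le> n" for j
  proof -
    let ?l = "column (Suc N) j"
    have l: "?l \<in> \<Gamma>'" "?l \<noteq> h"
      using j by (auto simp: \<Gamma>'_def h_def column_in_circles simp del: replicate_Suc)
    \<comment> \<open>The label carried to the new circle \<open>h\<close> is overwritten, so \<open>h\<close> is excluded.\<close>
    have upd: "ca (\<alpha>(column N j := z)) \<gamma> = ((ca \<alpha>)(?l := z)) \<gamma>" if \<gamma>: "\<gamma> \<in> \<Gamma>'" "\<gamma> \<noteq> h" for \<alpha> z \<gamma>
    proof -
      obtain i where "\<gamma> = column (Suc N) i" "1 \<le> i" "i \<le> n"
        using \<gamma> unfolding \<Gamma>'_def h_def circles_vert by (auto simp: le_Suc_eq)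
      then show ?thesis
        using ca by simp
    qed
    have first: "pure \<Gamma>' ((ca (\<alpha>(column N j := z)))(h := e)) = pure \<Gamma>' (((ca \<alpha>)(h := e))(?l := z))" for \<alpha> z e
      using upd l by (intro pure_cong) auto
    have second: "comult_at x1 x2 \<Gamma>' g h a (ca (\<alpha>(column N j := z))) = comult_at x1 x2 \<Gamma>' g h a ((ca \<alpha>)(?l := z))" for \<alpha> z a
      using upd by (intro comult_at_cong)
    show ?thesis
    proof (cases "j = n")
      case True
      then have "comult_at x1 x2 \<Gamma>' g h a ((ca \<alpha>)(?l := z)) = comult_at x1 x2 \<Gamma>' g h a (ca \<alpha>)" for \<alpha> z a
        by (intro comult_at_cong) (simp add: g_def)
      then show ?thesis
        unfolding slot_linear_def F_def first second using True gh
        by (simp add: pure_linear[OF gh(4) gh(2)[unfolded g_def]] comult_at_linear) (simp add: fun_eq_iff tscale_apply algebra_simps)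
    next
      case False
      then have "?l \<noteq> g"
        by (simp add: g_def)
      note lin = comult_at_slot_linear[OF gh(4) l(1) this l(2), unfolded slot_linear_def, rule_format]
      show ?thesis
        unfolding slot_linear_def F_def first second using False
        by (simp add: pure_linear[OF gh(4) l(1)] lin) (simp add: fun_eq_iff tscale_apply algebra_simps)
    qed
  qed
  have F_image: "linear_ext (circles n (vert N)) F (strand_state n (vert N) f) = strand_state (Suc n) (vert (Suc N)) f"
    using linear_ext_strands[OF slots alternating_degree[OF alt]] F_value by simp
  show "phi1_pos x1 x2 n w \<eta> (strand_chain n w f) r' = strand_chain (Suc n) (w @ [Pos n]) f r'"
  proof (cases "r' = oriented (w @ [Pos n])")
    case True
    have b: "butlast r' = oriented w" "last r' = False" "length r' = Suc (length w)"
      using butlast_oriented[OF True] True by simp_all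
    have lay: "layers (w @ [Pos n]) r' = vert (Suc N)" "layers w (butlast r') = vert N"
      unfolding b unfolding True layers_oriented N_def by simp_all
    have circs: "circ n (vert N) (0, n) = column N n" "circ (Suc n) (vert (Suc N)) (0, n) = g"
        "new_circle n (vert (Suc N)) = h"
      using assms(3) by (simp_all add: circ_vert new_circle_vert g_def h_def del: replicate_Suc)
    have "phi1_pos x1 x2 n w \<eta> (strand_chain n w f) r' =
        tscale (of_int (\<eta> r')) (linear_ext (circles n (vert N)) F (strand_chain n w f (butlast r')))"
      unfolding phi1_pos_def Let_def lay circs F_def comult_at_def \<Gamma>'_def ca_def using b by simp
    then show ?thesis
      using assms(2) F_image by (simp add: True strand_chain_apply b oriented_signs_def N_def butlast_oriented[OF refl])
  next
    case False
    then have "\<not> (length r' = Suc (length w) \<and> \<not> last r' \<and> butlast r' = oriented w)"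
      using oriented_lastI[of r' w "Pos n"] by auto
    then show ?thesis
      using False by (auto simp: phi1_pos_def strand_chain_apply Let_def)
  qed
qed

lemma psi1_pos_strands:
  assumes alt: "alternating x1 x2 f" and "oriented_signs w \<eta>"
  shows "psi1_pos n w \<eta> (strand_chain (Suc n) (w @ [Pos n]) f) = strand_chain n w f"
proof
  fix r :: "bool list"
  have "counit (f (Suc n)) = 1"
    using alt by (auto simp: alternating_def opposite_def x_white_def x_black_def counit_def dest!: spec[of _ n])
  then have dth: "death (Suc n) (vert (Suc (length w))) n (vert (length w)) Id (column (Suc (length w)) (Suc n))
      (strand_state (Suc n) (vert (Suc (length w))) f) = strand_state n (vert (length w)) f"
    by (subst death_strands) (simp_all add: keeps_strands_Id alternating_degree[OF alt])
  show "psi1_pos n w \<eta> (strand_chain (Suc n) (w @ [Pos n]) f) r = strand_chain n w f r"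
  proof (cases "r = oriented w")
    case True
    then have o: "r @ [False] = oriented (w @ [Pos n])"
      by (simp add: append_last_oriented)
    show ?thesis
      unfolding psi1_pos_def Let_def o
      using True dth assms(2) by (simp add: strand_chain_apply new_circle_vert oriented_signs_def del: replicate_Suc)
  next
    case False
    then have "length r = length w \<Longrightarrow> r @ [False] \<noteq> oriented (w @ [Pos n])"
      by (simp add: append_last_oriented)
    then show ?thesis
      using False by (auto simp: psi1_pos_def Let_def strand_chain_apply death_def)
  qed
qed

text \<open>
  The maps are normalized to have sign \<open>+\<close> on the oriented resolution, so each generating move
  preserves the chain exactly, and so do the compositions.
\<close>

lemma transverse_map_strands:
  assumes "transverse_map x1 x2 D D' \<Phi>" and alt: "alternating x1 x2 f"
  shows "\<Phi> (strand_chain (fst D) (fst (snd D)) f) = strand_chain (fst D') (fst (snd D')) f"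
  using assms(1)
proof induction
  case (conjugation n u v s s' \<eta>)
  then show ?case
    using conj_map_strands[OF _ alternating_degree[OF alt]] by simp
next
  case (far_commutation w u c c' v w' n s s' \<eta>)
  then show ?case
    using far_map_strands[OF _ alternating_degree[OF alt], of u c' c v \<eta> n] by simp
next
  case (insertion w u v w' c c' n s s' \<Psi>)
  then have "1 \<le> idx c" "Suc (idx c) \<le> n"
    by (simp_all add: braid_def)
  with insertion show ?case
    using psi2_map_strands[OF alt] by (simp only: fst_conv snd_conv)
next
  case (cancellation w u c c' v w' n s s' \<Phi>)
  then show ?case
    using phi2_map_strands[OF alt] by (simp only: fst_conv snd_conv)
next
  case (third_move w u c1 c c2 v w' c1' c' c2' n s s' \<Psi>)
  then show ?case
    using r3_map_strands[OF alt] by (simp only: fst_conv snd_conv)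
next
  case (positive_stabilization n w w' s s' \<eta>)
  then show ?case
    using phi1_pos_strands[OF alt] by (simp add: braid_def)
next
  case (positive_destabilization n w w' s s' \<eta>)
  then show ?case
    using psi1_pos_strands[OF alt] by simp
qed simp_all

section \<open>Negative stabilization\<close>

lemma phi1_neg_strands:
  assumes deg: "\<And>j. degree (f j) < 2" and "oriented_signs (w @ [Neg n]) \<eta>"
  shows "phi1_neg n w \<eta> (strand_chain n w f) = strand_chain (Suc n) (w @ [Neg n]) (f(Suc n := 1))"
proof
  fix r' :: "bool list"
  let ?N = "length w"
  show "phi1_neg n w \<eta> (strand_chain n w f) r' = strand_chain (Suc n) (w @ [Neg n]) (f(Suc n := 1)) r'"
  proof (cases "r' = oriented (w @ [Neg n])")
    case True
    have b: "butlast r' = oriented w" "last r' = True" "length r' = Suc (length w)"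
      using butlast_oriented[OF True] True by simp_all
    have lay: "layers (w @ [Neg n]) r' = vert (Suc ?N)" "layers w (butlast r') = vert ?N"
      unfolding b unfolding True layers_oriented by simp_all
    have "strand_chain n w f (butlast r') = strand_state n (vert ?N) f"
      by (simp add: b strand_chain_apply)
    then have "phi1_neg n w \<eta> (strand_chain n w f) r' = tscale (of_int (\<eta> r'))
        (birth n (vert ?N) (Suc n) (vert (Suc ?N)) Id (column (Suc ?N) (Suc n)) (strand_state n (vert ?N) f))"
      unfolding phi1_neg_def Let_def lay new_circle_vert using b by simp
    also have "\<dots> = strand_state (Suc n) (vert (Suc ?N)) (f(Suc n := 1))"
      using assms(2) by (simp only: birth_strands[OF keeps_strands_Id deg] True oriented_signs_def of_int_1 tscale_simps)
    finally show ?thesis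
      by (simp add: True strand_chain_apply)
  next
    case False
    then have "\<not> (length r' = Suc (length w) \<and> last r' \<and> butlast r' = oriented w)"
      using oriented_lastI[of r' w "Neg n"] by auto
    then show ?thesis
      using False by (auto simp: phi1_neg_def strand_chain_apply Let_def birth_def)
  qed
qed

text \<open>
  The saddle from the stack with fused strands splits the fused circle, labelled \<open>f n\<close>; by
  \<open>\<Delta>(a) = a \<otimes> a\<close> both resulting strands are labelled \<open>f n\<close>.
\<close>

lemma saddle_capped:
  assumes alt: "alternating x1 x2 f" and "1 \<le> n"
  shows "saddle x1 x2 (Suc n) (capped n N) (vert (Suc N)) N n (strand_state (Suc n) (capped n N) f) =
    strand_state (Suc n) (vert (Suc N)) (f(Suc n := f n))"
proof -
  define \<Gamma> \<Gamma>' where "\<Gamma> = circles (Suc n) (capped n N)" and "\<Gamma>' = circles (Suc n) (vert (Suc N))"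
  define m g h where "m = column (Suc N) n \<union> column (Suc N) (Suc n)"
    and "g = column (Suc N) n" and "h = column (Suc N) (Suc n)"
  define F where "F = (\<lambda>\<alpha>. comult_at x1 x2 \<Gamma>' g h (\<alpha> m) \<alpha>)"
  have \<Gamma>: "\<Gamma> = insert m (column (Suc N) ` {1..<n})"
    using circles_capped[OF assms(2)] by (simp add: \<Gamma>_def m_def)
  have gh: "g \<noteq> h" "g \<in> \<Gamma>'" "h \<in> \<Gamma>'" "finite \<Gamma>'"
    using assms(2) by (auto simp: g_def h_def \<Gamma>'_def column_in_circles finite_circles simp del: replicate_Suc)
  have m_col: "m \<noteq> column (Suc N) j" for j
  proof -
    have "(0, n) \<in> m" "(0, Suc n) \<in> m"
      by (auto simp: m_def column_def)
    then show ?thesis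
      by (auto simp: column_def)
  qed
  then have m_out: "m \<notin> \<Gamma>'"
    by (auto simp: \<Gamma>'_def circles_vert simp del: replicate_Suc)
  have circs: "circ (Suc n) (capped n N) (N, n) = m" "circ (Suc n) (capped n N) (Suc N, Suc n) = m"
    "circ (Suc n) (vert (Suc N)) (N, n) = g" "circ (Suc n) (vert (Suc N)) (Suc N, Suc n) = h"
    using assms(2) by (simp_all add: circ_capped circ_vert m_def g_def h_def del: replicate_Suc)
  have "saddle x1 x2 (Suc n) (capped n N) (vert (Suc N)) N n t = linear_ext \<Gamma> F t" for t
    unfolding saddle_def Let_def circs F_def comult_at_def \<Gamma>_def \<Gamma>'_def by simp
  then have "saddle x1 x2 (Suc n) (capped n N) (vert (Suc N)) N n (strand_state (Suc n) (capped n N) f) =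
      linear_ext \<Gamma> F (pure \<Gamma> (\<lambda>\<gamma>. f (strand \<gamma>)))"
    by (simp only: strand_state_def \<Gamma>_def)
  also have "\<dots> = F (\<lambda>\<gamma>. if \<gamma> \<in> \<Gamma> then f (strand \<gamma>) else 1)"
  proof (rule linear_ext_pure)
    show "finite \<Gamma>"
      by (simp add: \<Gamma>)
    show "degree (f (strand \<gamma>)) < 2" for \<gamma>
      by (rule alternating_degree[OF alt])
    fix \<gamma> assume "\<gamma> \<in> \<Gamma>"
    then consider "\<gamma> = m" | j where "\<gamma> = column (Suc N) j" "1 \<le> j" "j < n"
      by (auto simp: \<Gamma>)
    then show "slot_linear F \<gamma>"
    proof cases
      case 1
      have "comult_at x1 x2 \<Gamma>' g h a (\<alpha>(m := z)) = comult_at x1 x2 \<Gamma>' g h a \<alpha>" for a \<alpha> z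
        using m_out by (intro comult_at_cong) auto
      then show ?thesis
        using gh by (simp add: 1 slot_linear_def F_def comult_at_linear)
    next
      case 2
      then have "\<gamma> \<in> \<Gamma>'" "\<gamma> \<noteq> g" "\<gamma> \<noteq> h" "m \<noteq> \<gamma>"
        using m_col by (auto simp: \<Gamma>'_def g_def h_def column_in_circles simp del: replicate_Suc)
      then show ?thesis
        using comult_at_slot_linear[OF gh(4), of \<gamma> g h x1 x2] by (simp add: slot_linear_def F_def)
    qed
  qed
  also have "\<dots> = strand_state (Suc n) (vert (Suc N)) (f(Suc n := f n))"
  proof -
    have "m \<in> \<Gamma>" "strand m = n"
      by (simp_all add: \<Gamma> m_def)
    then show ?thesis
      unfolding F_def \<Gamma>'_def g_def h_def
      by (simp only: if_True) (intro comult_at_strands[OF alt assms(2)], simp add: \<Gamma>)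
  qed
  finally show ?thesis .
qed

lemma saddle_tscale: "saddle x1 x2 n fs fs' k i (tscale c t) = tscale c (saddle x1 x2 n fs fs' k i t)"
  by (simp only: saddle_def Let_def linear_ext_tscale)

text \<open>
  Of the crossings of \<open>w\<close>, only the positive ones contribute, and they merge circles whose outermost
  strands are \<open>i\<close> and \<open>i + 1\<close> with \<open>i + 1 \<le> n\<close>; so only the new crossing survives.
\<close>

lemma diff_capped:
  assumes alt: "alternating x1 x2 f" and "braid n w" and w': "w' = w @ [Neg n]"
  shows "diff x1 x2 (Suc n) w' s
      (concentrated (oriented w @ [False]) (tscale c (strand_state (Suc n) (capped n (length w)) f))) =
    concentrated (oriented w')
      (tscale (of_int (s (oriented w @ [False]) (oriented w')) * c)
        (strand_state (Suc n) (vert (Suc (length w))) (f(Suc n := f n))))"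
proof -
  let ?N = "length w" and ?r = "oriented w @ [False]"
  let ?t = "strand_state (Suc n) (capped n ?N) f"
  have n: "1 \<le> n"
    using assms(2) by (simp add: braid_def)
  have r': "?r[?N := True] = oriented w'"
    by (simp add: w' oriented_def list_update_append)
  have lay: "layers w' ?r = capped n ?N"
    by (simp add: w' layers_append) (simp add: layers_def)
  have "diff_at x1 x2 (Suc n) w' s k (concentrated ?r (tscale c ?t)) = 0" if k: "k < ?N" for k
  proof (rule diff_at_concentrated_zero)
    assume "\<not> ?r ! k"
    then obtain i where i: "w ! k = Pos i"
      using k by (cases "w ! k") (auto simp: oriented_def nth_append)
    \<comment> \<open>As \<open>i < n\<close>, the circle through the strand \<open>i + 1\<close> is a single strand or the fused one, of label \<open>f n\<close>.\<close>
    then have i': "1 \<le> i" "i < n"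
      using assms(2) k nth_mem[of k w] by (fastforce simp: braid_def)+
    have upd: "layers w' (?r[k := True]) = (capped n ?N)[k := Cupcap i]"
      using k i by (subst layers_update) (auto simp: w' lay[unfolded w'] nth_append)
    have strands: "strand (circ (Suc n) (capped n ?N) (k, i)) = i"
      "strand (circ (Suc n) (capped n ?N) (Suc k, Suc i)) = Suc i"
      using k i' n by (auto simp: circ_capped less_le dest: le_antisym)
    have "saddle x1 x2 (Suc n) (capped n ?N) ((capped n ?N)[k := Cupcap i]) k i ?t = 0"
      using k i' by (intro strand_state_merge_zero[OF alt _ _ _ _ strands]) (auto simp: nth_append)
    then show "saddle x1 x2 (Suc n) (layers w' ?r) (layers w' (?r[k := True])) k (idx (w' ! k)) (tscale c ?t) = 0"
      using k i unfolding lay upd saddle_tscale by (simp add: w' nth_append)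
  qed (use k in \<open>simp_all add: w'\<close>)
  moreover have "diff_at x1 x2 (Suc n) w' s ?N (concentrated ?r (tscale c ?t)) =
      concentrated (oriented w') (tscale (of_int (s ?r (oriented w')) * c)
        (strand_state (Suc n) (vert (Suc ?N)) (f(Suc n := f n))))"
  proof -
    have "layers w' (oriented w') = vert (Suc ?N)"
      by (simp only: layers_oriented) (simp add: w')
    moreover have "idx (w' ! ?N) = n"
      by (simp add: w' nth_append)
    moreover have "length ?r = length w'" "?N < length w'" "\<not> ?r ! ?N"
      by (simp_all add: w' nth_append)
    moreover have "tscale a (tscale c t) = tscale (a * c) t" for a and t :: "'a tensor"
      by (simp add: fun_eq_iff tscale_apply mult.assoc)
    ultimately show ?thesis
      by (simp only: simp_thms diff_at_concentrated r' lay saddle_tscale saddle_capped[OF alt n])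
  qed
  moreover have "length w' = Suc ?N"
    by (simp add: w')
  ultimately show ?thesis
    by (simp add: diff_def)
qed

text \<open>
  The chain \<open>x\<close> is the state with fused innermost strands, up to sign: \<open>\<sigma>\<close> is the sign of the edge
  along which the fused circle splits, and \<open>\<delta>\<close> compares the order of the labels of the strands \<open>n\<close> and
  \<open>n + 1\<close> with that of \<open>x\<^sub>1\<close> and \<open>x\<^sub>2\<close>.
\<close>

lemma negative_stabilization_strands:
  assumes alt: "alternating x1 x2 f" and "braid n w" and w': "w' = w @ [Neg n]"
    and "sign_function (length w') s'" "negative_stabilization_map x1 x2 n w s s' \<Phi>"
  shows "\<exists>\<epsilon>\<in>{1, -1}. \<exists>x\<in>chains (Suc n) w'.
    cscale (x1 - x2) (\<Phi> (strand_chain n w f)) =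
    cscale \<epsilon> (strand_chain (Suc n) w' f) + diff x1 x2 (Suc n) w' s' x"
proof -
  let ?N = "length w" and ?r = "oriented w @ [False]"
  define S where "S a = strand_state (Suc n) (vert (Suc ?N)) (f(Suc n := a))" for a
  define \<sigma> where "\<sigma> = (of_int (s' ?r (oriented w')) :: 'a)"
  obtain \<eta> where \<eta>: "oriented_signs w' \<eta>" "\<Phi> = phi1_neg n w \<eta>"
    using assms(5) unfolding negative_stabilization_map_def w' by (elim conjE exE)
  have \<Phi>: "\<Phi> (strand_chain n w f) = concentrated (oriented w') (S 1)"
    using phi1_neg_strands[OF alternating_degree[OF alt] \<eta>(1)[unfolded w']]
    by (simp add: \<eta>(2) strand_chain_def S_def w' del: replicate_Suc)
  have \<beta>': "strand_chain (Suc n) w' f = concentrated (oriented w') (S (f (Suc n)))"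
    by (simp add: strand_chain_def S_def w' del: replicate_Suc)
  have "opposite x1 x2 (f n) (f (Suc n))"
    using alt by (simp add: alternating_def)
  then obtain y z where yz: "f n = [:- y, 1:]" "f (Suc n) = [:- z, 1:]"
      "x1 - x2 = y - z \<or> x1 - x2 = - (y - z)"
    by (elim opposite_cases)
  then obtain \<delta> where \<delta>: "\<delta> \<in> {1, -1}" "x1 - x2 = \<delta> * (y - z)"
    by (metis insertI1 insertI2 mult_1 mult_minus1)
  \<comment> \<open>\<open>b = a + (y - z)\<close>, whence \<open>a \<otimes> b = a \<otimes> a + (y - z) (a \<otimes> 1)\<close>.\<close>
  have "f (Suc n) = smult 1 (f n) + smult (y - z) 1"
    by (simp add: yz one_pCons)
  then have split: "S (f (Suc n)) = tscale 1 (S (f n)) + tscale (y - z) (S 1)"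
    unfolding S_def by (simp only: strand_state_last_linear)
  have "precedes (length w') ?r (oriented w')"
    unfolding precedes_def w' by (intro conjI exI[of _ ?N]) (auto simp: oriented_def nth_append list_update_append)
  then have "s' ?r (oriented w') \<in> {1, -1}"
    using assms(4) unfolding sign_function_def by blast
  then have \<sigma>: "\<sigma> * \<sigma> = 1"
    by (auto simp: \<sigma>_def)
  define x where "x = concentrated ?r (tscale (- (\<delta> * \<sigma>)) (strand_state (Suc n) (capped n ?N) f))"
  have lay: "layers w' ?r = capped n ?N"
    by (simp add: w' layers_append) (simp add: layers_def)
  have x: "x \<in> chains (Suc n) w'"
    unfolding chains_def mem_Collect_eq
  proof (intro allI impI)
    fix r T assume "x r T \<noteq> 0"
    then have "r = ?r" "strand_state (Suc n) (capped n ?N) f T \<noteq> 0"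
      by (auto simp: x_def concentrated_def tscale_apply split: if_splits)
    then show "length r = length w' \<and> T \<subseteq> circles (Suc n) (layers w' r)"
      using strand_state_support[of "Suc n" "capped n ?N" f T] by (simp only: lay) (simp add: w')
  qed
  have "diff x1 x2 (Suc n) w' s' x = concentrated (oriented w') (tscale (- \<delta>) (S (f n)))"
  proof -
    have "\<sigma> * - (\<delta> * \<sigma>) = - \<delta>"
      using \<sigma> by (simp add: mult.left_commute)
    then show ?thesis
      unfolding x_def diff_capped[OF alt assms(2) w'] by (simp only: S_def flip: \<sigma>_def)
  qed
  then have "cscale (x1 - x2) (\<Phi> (strand_chain n w f)) =
      cscale \<delta> (strand_chain (Suc n) w' f) + diff x1 x2 (Suc n) w' s' x"
    unfolding \<Phi> \<beta>' split \<delta>(2)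
    by (auto simp: fun_eq_iff cscale_def concentrated_def tscale_apply algebra_simps)
  with \<delta>(1) x show ?thesis
    by blast
qed

section \<open>Invariance of the beta-cycles\<close>

text \<open>
  The strand \<open>j\<close> has \<open>j - 1\<close> strands to its left.
\<close>

lemma beta_strands:
  "beta x1 x2 n w = strand_chain n w (\<lambda>j. if odd j then x_white x1 else x_black x2)"
  "beta_bar x1 x2 n w = strand_chain n w (\<lambda>j. if odd j then x_black x2 else x_white x1)"
proof -
  have "winding n (vert N) (column N j) = 0 \<longleftrightarrow> odd j" if "1 \<le> j" "j \<le> n" for N j
    unfolding winding_column[OF that] using that by (cases j) auto
  then have col: "pure (circles n (vert N)) (\<lambda>\<gamma>. if winding n (vert N) \<gamma> = 0 then a else b) =
      strand_state n (vert N) (\<lambda>j. if odd j then a else b)" for N and a b :: "'a poly"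
    by (intro strand_state_vert_cong) simp
  show "beta x1 x2 n w = strand_chain n w (\<lambda>j. if odd j then x_white x1 else x_black x2)"
    "beta_bar x1 x2 n w = strand_chain n w (\<lambda>j. if odd j then x_black x2 else x_white x1)"
    by (auto simp: beta_def beta_bar_def strand_chain_apply Let_def col fun_eq_iff)
qed

lemma alternating_white_black:
  "alternating x1 x2 (\<lambda>j. if odd j then x_white x1 else x_black x2)"
  "alternating x1 x2 (\<lambda>j. if odd j then x_black x2 else x_white x1)"
  by (auto simp: alternating_def opposite_def)

theorem theorem1p3:
  fixes \<pi> :: "'f::field poly poly \<Rightarrow> 'r::comm_ring_1"
    and p q :: "'f poly poly"
    and x1 x2 :: 'r
  assumes "prime_ideal2 p q" and "quotient_map \<pi> p q"
  shows
    "(\<forall>n w s. braid n w \<and> sign_function (length w) s \<longrightarrow>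
        beta x1 x2 n w \<in> chains_deg n w 0 \<and> diff x1 x2 n w s (beta x1 x2 n w) = 0 \<and>
        beta_bar x1 x2 n w \<in> chains_deg n w 0 \<and> diff x1 x2 n w s (beta_bar x1 x2 n w) = 0) \<and>
     (\<forall>n w s n' w' s' \<Phi>. transverse_map x1 x2 (n, w, s) (n', w', s') \<Phi> \<longrightarrow>
        \<Phi> (beta x1 x2 n w) = beta x1 x2 n' w' \<and>
        \<Phi> (beta_bar x1 x2 n w) = beta_bar x1 x2 n' w') \<and>
     (\<forall>n w s w' s' \<Phi>. braid n w \<and> w' = w @ [Neg n] \<and>
        sign_function (length w) s \<and> sign_function (length w') s' \<and>
        negative_stabilization_map x1 x2 n w s s' \<Phi> \<longrightarrow>
        (\<exists>\<epsilon>\<in>{1, -1}. \<exists>x\<in>chains (Suc n) w'.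
           cscale (x1 - x2) (\<Phi> (beta x1 x2 n w)) =
           cscale \<epsilon> (beta x1 x2 (Suc n) w') + diff x1 x2 (Suc n) w' s' x) \<and>
        (\<exists>\<epsilon>\<in>{1, -1}. \<exists>y\<in>chains (Suc n) w'.
           cscale (x1 - x2) (\<Phi> (beta_bar x1 x2 n w)) =
           cscale \<epsilon> (beta_bar x1 x2 (Suc n) w') + diff x1 x2 (Suc n) w' s' y))"
  unfolding beta_strands
proof (intro conjI allI impI; (elim conjE)?)
  fix n w s n' w' s' \<Phi>
  assume t: "transverse_map x1 x2 (n, w, s) (n', w', s') \<Phi>"
  show "\<Phi> (strand_chain n w (\<lambda>j. if odd j then x_white x1 else x_black x2)) =
      strand_chain n' w' (\<lambda>j. if odd j then x_white x1 else x_black x2)"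
    using transverse_map_strands[OF t alternating_white_black(1)] by simp
  show "\<Phi> (strand_chain n w (\<lambda>j. if odd j then x_black x2 else x_white x1)) =
      strand_chain n' w' (\<lambda>j. if odd j then x_black x2 else x_white x1)"
    using transverse_map_strands[OF t alternating_white_black(2)] by simp
qed (rule strand_chain_in_chains_deg diff_strand_chain negative_stabilization_strands alternating_white_black | assumption)+

end
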